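(* Let $\mathcal G_1$ and $\mathcal G_2$ be monotone graph classes each containing $K_2$. Then $\operatorname{tw}(\mathcal G_1\times\mathcal G_2)$ is bounded if and only if $\operatorname{tw}(\mathcal G_1)$ and $\operatorname{tw}(\mathcal G_2)$ are bounded and at least one of the following holds: (i) $\tilde{\mathsf v}(\mathcal G_1)$ or $\tilde{\mathsf v}(\mathcal G_2)$ is bounded; (ii) $\tilde\tau(\mathcal G_1)$ and $\Delta(\mathcal G_2)$ are bounded; (iii) $\tilde\tau(\mathcal G_2)$ and $\Delta(\mathcal G_1)$ are bounded.
   Context: A graph class is a set of graphs closed under isomorphism containing a graph with non-empty vertex set; it is monotone if closed under subgraphs. For a graph parameter $\beta$, $\beta(\mathcal G):=\sup\{\beta(G):G\in\mathcal G\}$, bounded if finite. $\operatorname{tw}$ is treewidth, $\Delta$ is maximum degree, $\tilde{\mathsf v}(G)$ is the maximum number of vertices of a connected component of $G$, and $\tilde\tau(G)$ is the maximum vertex cover number of a connected component of $G$ (the vertex cover number of a graph is the minimum size of a vertex set whose complement is independent). $\mathcal G_1\times\mathcal G_2:=\{G_1\times G_2:G_i\in\mathcal G_i\}$, where the direct product $G_1 \times G_2$ has vertex set $V(G_1)\times V(G_2)$ and $(a,v)(b,u)$ is an edge iff $ab\in E(G_1)$ and $uv\in E(G_2)$. *)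

theory Defs
  imports Main
begin

type_synonym 'a graph = "'a set \<times> 'a set set"

definition gV :: "'a graph \<Rightarrow> 'a set" where "gV G = fst G"
definition gE :: "'a graph \<Rightarrow> 'a set set" where "gE G = snd G"

definition wf_graph :: "'a graph \<Rightarrow> bool" where
  "wf_graph G \<longleftrightarrow> finite (gV G) \<and>
     (\<forall>e\<in>gE G. \<exists>u v. e = {u, v} \<and> u \<noteq> v \<and> u \<in> gV G \<and> v \<in> gV G)"

definition graph_iso :: "'a graph \<Rightarrow> 'b graph \<Rightarrow> bool" where
  "graph_iso G H \<longleftrightarrow> (\<exists>f. bij_betw f (gV G) (gV H) \<and>
     (\<forall>u\<in>gV G. \<forall>v\<in>gV G. {u, v} \<in> gE G \<longleftrightarrow> {f u, f v} \<in> gE H))"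

definition subgraph :: "'a graph \<Rightarrow> 'a graph \<Rightarrow> bool" where
  "subgraph H G \<longleftrightarrow> wf_graph H \<and> gV H \<subseteq> gV G \<and> gE H \<subseteq> gE G"

definition induced :: "'a graph \<Rightarrow> 'a set \<Rightarrow> 'a graph" where
  "induced G S = (S \<inter> gV G, {e \<in> gE G. e \<subseteq> S})"

definition graph_class :: "nat graph set \<Rightarrow> bool" where
  "graph_class C \<longleftrightarrow> (\<forall>G\<in>C. wf_graph G) \<and>
     (\<forall>G\<in>C. \<forall>H. wf_graph H \<and> graph_iso G H \<longrightarrow> H \<in> C) \<and>
     (\<exists>G\<in>C. gV G \<noteq> {})"

definition monotone_class :: "nat graph set \<Rightarrow> bool" where
  "monotone_class C \<longleftrightarrow> graph_class C \<and> (\<forall>G\<in>C. \<forall>H. subgraph H G \<longrightarrow> H \<in> C)"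

definition K2 :: "nat graph" where "K2 = ({0, 1}, {{0, 1}})"

definition contains_K2 :: "nat graph set \<Rightarrow> bool" where
  "contains_K2 C \<longleftrightarrow> (\<exists>G\<in>C. graph_iso G K2)"

definition reach :: "'a graph \<Rightarrow> 'a \<Rightarrow> 'a \<Rightarrow> bool" where
  "reach G u v \<longleftrightarrow> u \<in> gV G \<and> (\<lambda>x y. {x, y} \<in> gE G)\<^sup>*\<^sup>* u v"

definition connected_graph :: "'a graph \<Rightarrow> bool" where
  "connected_graph G \<longleftrightarrow> gV G \<noteq> {} \<and> (\<forall>u\<in>gV G. \<forall>v\<in>gV G. reach G u v)"

definition is_tree :: "'a graph \<Rightarrow> bool" where
  "is_tree T \<longleftrightarrow> wf_graph T \<and> connected_graph T \<and> card (gE T) + 1 = card (gV T)"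

definition tree_decomp :: "'a graph \<Rightarrow> nat graph \<Rightarrow> (nat \<Rightarrow> 'a set) \<Rightarrow> bool" where
  "tree_decomp G T B \<longleftrightarrow> is_tree T \<and>
     (\<forall>t\<in>gV T. B t \<subseteq> gV G) \<and>
     (\<forall>v\<in>gV G. \<exists>t\<in>gV T. v \<in> B t) \<and>
     (\<forall>e\<in>gE G. \<exists>t\<in>gV T. e \<subseteq> B t) \<and>
     (\<forall>v\<in>gV G. connected_graph (induced T {t \<in> gV T. v \<in> B t}))"

text \<open>Treewidth: least k such that there is a tree decomposition of width at most k
  (all bags of size at most k+1). The empty graph gets treewidth 0.\<close>
definition treewidth :: "'a graph \<Rightarrow> nat" where
  "treewidth G = (LEAST k. \<exists>T B. tree_decomp G T B \<and> (\<forall>t\<in>gV T. card (B t) \<le> k + 1))"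

definition degree :: "'a graph \<Rightarrow> 'a \<Rightarrow> nat" where
  "degree G v = card {e \<in> gE G. v \<in> e}"

definition max_degree :: "'a graph \<Rightarrow> nat" where
  "max_degree G = Max (insert 0 (degree G ` gV G))"

definition component :: "'a graph \<Rightarrow> 'a \<Rightarrow> 'a set" where
  "component G v = {u. reach G v u}"

definition components :: "'a graph \<Rightarrow> 'a set set" where
  "components G = component G ` gV G"

definition max_comp_size :: "'a graph \<Rightarrow> nat" where
  "max_comp_size G = Max (insert 0 (card ` components G))"

definition vertex_cover_number :: "'a graph \<Rightarrow> nat" where
  "vertex_cover_number G = Min {card S | S. S \<subseteq> gV G \<and> (\<forall>e\<in>gE G. e \<inter> S \<noteq> {})}"

definition max_comp_vc :: "'a graph \<Rightarrow> nat" where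
  "max_comp_vc G = Max (insert 0 ((\<lambda>C. vertex_cover_number (induced G C)) ` components G))"

definition direct_prod :: "'a graph \<Rightarrow> 'b graph \<Rightarrow> ('a \<times> 'b) graph" where
  "direct_prod G H = (gV G \<times> gV H,
     {{(a, v), (b, u)} | a b u v. {a, b} \<in> gE G \<and> {u, v} \<in> gE H})"

definition prod_class :: "'a graph set \<Rightarrow> 'b graph set \<Rightarrow> ('a \<times> 'b) graph set" where
  "prod_class C D = {direct_prod G H | G H. G \<in> C \<and> H \<in> D}"

definition bounded_param :: "('a graph \<Rightarrow> nat) \<Rightarrow> 'a graph set \<Rightarrow> bool" where
  "bounded_param f C \<longleftrightarrow> (\<exists>k. \<forall>G\<in>C. f G \<le> k)"

end

theory Submission
  imports Defs
begin

text \<open>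
  Bounded treewidth is replaced by bounded balanced separators: for every vertex weighting there is
  a set of at most \<open>s\<close> vertices whose removal leaves components of at most half the weight.

  A balanced separator of one factor gives one of the product: take its product with a component of
  bounded size of the other factor, or the product of its closed neighbourhood with a small vertex
  cover of such a component.

  Conversely, let \<open>S\<close> separate \<open>G \<times> K\<^sub>2\<close> with the weights pulled back from \<open>G\<close>. A component of
  \<open>G\<close> minus the projection of \<open>S\<close> carrying more than half of the weight must be bipartite, hence
  lifts isomorphically to \<open>G \<times> K\<^sub>2\<close>, where a second separator splits it. So \<open>G\<close> has bounded
  treewidth. If none of the three alternatives holds, the product contains star \<open>\<times>\<close> star,
  path \<open>\<times>\<close> path or spider \<open>\<times>\<close> path of unbounded size, because a connected graph without long paths
  and without large spiders (legs of length two) has a small vertex cover. Each of these products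
  has many disjoint rows and columns meeting pairwise, which no small separator can balance.
\<close>

section \<open>Balanced separators\<close>

text \<open>Balanced separators fit products because a weighting can be summed over the fibres of a
  projection or restricted to a lifted copy; hence all weightings are allowed, not only vertex
  counting. The price is a linear loss in the width, which boundedness ignores. The obstacle in the
  converse is that a non-bipartite \<open>G\<close> has no copy in its bipartite double cover
  \<open>G \<times> K\<^sub>2\<close>, so the treewidth of a factor cannot be read off from a
  subgraph of the product. The shape of the alternatives comes from the obstructions. Star \<times>
  star forces one of the two maximum degrees to be bounded, say that of the second class. If its
  components are unboundedly large, they have unbounded vertex cover number, since a small cover and
  bounded degree leave few vertices. Bounded degree excludes large spiders, so this class has long
  paths. The other class then has neither long paths nor large spiders, so its vertex cover number
  is bounded.\<close>

definition rch :: "'a graph \<Rightarrow> 'a set \<Rightarrow> 'a \<Rightarrow> 'a \<Rightarrow> bool" where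
  "rch G X = (\<lambda>x y. {x, y} \<in> gE G \<and> x \<in> X \<and> y \<in> X)\<^sup>*\<^sup>*"

lemma rch_refl [simp]: "rch G X x x"
  by (simp add: rch_def)

lemma rch_trans [trans]: "rch G X x y \<Longrightarrow> rch G X y z \<Longrightarrow> rch G X x z"
  unfolding rch_def by (rule rtranclp_trans)

lemma rch_step: "{x, y} \<in> gE G \<Longrightarrow> x \<in> X \<Longrightarrow> y \<in> X \<Longrightarrow> rch G X x y"
  unfolding rch_def by (rule r_into_rtranclp) simp

lemma rch_sym: "rch G X x y \<Longrightarrow> rch G X y x"
  unfolding rch_def
proof (induction rule: rtranclp_induct)
  case (step y z)
  then have "{z, y} \<in> gE G \<and> z \<in> X \<and> y \<in> X" by (simp add: insert_commute)
  then show ?case using step.IH by (rule converse_rtranclp_into_rtranclp)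
qed simp

lemma rch_mono: "rch G X x y \<Longrightarrow> X \<subseteq> Y \<Longrightarrow> rch G Y x y"
  unfolding rch_def by (erule rtranclp_mono[THEN predicate2D, rotated]) auto

lemma rch_induct [consumes 1, case_names base step]:
  assumes "rch G X x y" and "P x"
    and "\<And>u v. P u \<Longrightarrow> rch G X x u \<Longrightarrow> {u, v} \<in> gE G \<Longrightarrow> u \<in> X \<Longrightarrow> v \<in> X \<Longrightarrow> P v"
  shows "P y"
  using assms(1) unfolding rch_def
proof (induction rule: rtranclp_induct)
  case base
  show ?case by (rule assms(2))
next
  case (step u v)
  then show ?case using assms(3)[of u v] by (simp add: rch_def)
qed

lemma rch_closed:
  assumes "rch G X x y" and "x \<in> Y"
    and "\<And>u v. u \<in> Y \<Longrightarrow> {u, v} \<in> gE G \<Longrightarrow> u \<in> X \<Longrightarrow> v \<in> X \<Longrightarrow> v \<in> Y"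
  shows "y \<in> Y"
  using assms(1) by (induction rule: rch_induct) (use assms(2,3) in auto)

lemma rch_map:
  assumes "rch G X x y"
    and "\<And>u v. {u, v} \<in> gE G \<Longrightarrow> u \<in> X \<Longrightarrow> v \<in> X \<Longrightarrow> {h u, h v} \<in> gE H \<and> h u \<in> Y \<and> h v \<in> Y"
  shows "rch H Y (h x) (h y)"
  using assms(1)
proof (induction rule: rch_induct)
  case (step u v)
  then have "rch H Y (h u) (h v)" using assms(2) by (intro rch_step) auto
  with step(1) show ?case by (rule rch_trans)
qed simp

lemma rch_in: "rch G X x y \<Longrightarrow> x \<in> X \<Longrightarrow> y \<in> X"
  by (rule rch_closed)

lemma wf_edge:
  assumes "wf_graph G" and "{u, v} \<in> gE G"
  shows "u \<in> gV G" and "v \<in> gV G" and "u \<noteq> v"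
  using assms unfolding wf_graph_def by (metis doubleton_eq_iff)+

lemma wf_finite: "wf_graph G \<Longrightarrow> finite (gV G)"
  by (simp add: wf_graph_def)

lemma reach_iff_rch:
  assumes "wf_graph G"
  shows "reach G u v \<longleftrightarrow> u \<in> gV G \<and> rch G (gV G) u v"
proof -
  have "(\<lambda>x y. {x, y} \<in> gE G) = (\<lambda>x y. {x, y} \<in> gE G \<and> x \<in> gV G \<and> y \<in> gV G)"
    using wf_edge[OF assms] by blast
  then show ?thesis by (simp add: reach_def rch_def)
qed

lemma connected_induced_iff:
  assumes "X \<subseteq> gV G"
  shows "connected_graph (induced G X) \<longleftrightarrow> X \<noteq> {} \<and> (\<forall>u\<in>X. \<forall>v\<in>X. rch G X u v)"
proof -
  have "(\<lambda>x y. {x, y} \<in> gE (induced G X)) = (\<lambda>x y. {x, y} \<in> gE G \<and> x \<in> X \<and> y \<in> X)"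
    by (auto simp: induced_def gE_def)
  moreover have "gV (induced G X) = X"
    using assms by (auto simp: induced_def gV_def)
  ultimately show ?thesis by (simp add: connected_graph_def reach_def rch_def)
qed

definition light :: "'a graph \<Rightarrow> ('a \<Rightarrow> nat) \<Rightarrow> 'a set \<Rightarrow> 'a \<Rightarrow> bool" where
  "light G w S x \<longleftrightarrow> 2 * sum w {y \<in> gV G. rch G (gV G - S) x y} \<le> sum w (gV G)"

definition bal_sep :: "'a graph \<Rightarrow> ('a \<Rightarrow> nat) \<Rightarrow> 'a set \<Rightarrow> bool" where
  "bal_sep G w S \<longleftrightarrow> S \<subseteq> gV G \<and> (\<forall>x \<in> gV G - S. light G w S x)"

text \<open>The separator may depend on \<open>w\<close>, its size may not. Zero weights are
  allowed, so a weighting can be concentrated on a chosen vertex set.\<close>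

definition wsep :: "nat \<Rightarrow> 'a graph \<Rightarrow> bool" where
  "wsep s G \<longleftrightarrow> (\<forall>w. \<exists>S. bal_sep G w S \<and> card S \<le> s)"

text \<open>\<open>Y\<close> only has to enclose the component of \<open>x\<close>: it contains
  \<open>x\<close> and no edge avoiding \<open>S\<close> leaves it. This saves computing
  components.\<close>

lemma lightI:
  assumes "finite (gV G)" and "Y \<subseteq> gV G" and "x \<in> Y"
    and "\<And>u v. u \<in> Y \<Longrightarrow> v \<in> gV G \<Longrightarrow> u \<notin> S \<Longrightarrow> v \<notin> S \<Longrightarrow> {u, v} \<in> gE G \<Longrightarrow> v \<in> Y"
    and "2 * sum w Y \<le> sum w (gV G)"
  shows "light G w S x"
proof -
  have "{y \<in> gV G. rch G (gV G - S) x y} \<subseteq> Y"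
  proof safe
    fix y assume "rch G (gV G - S) x y"
    then show "y \<in> Y" by (rule rch_closed) (use assms in auto)
  qed
  then have "sum w {y \<in> gV G. rch G (gV G - S) x y} \<le> sum w Y"
    using assms(1,2) by (intro sum_mono2) (auto intro: finite_subset)
  then show ?thesis using assms(5) by (simp add: light_def)
qed

text \<open>The counterpart of \<open>lightI\<close>: here \<open>Y\<close> is approximated from
  inside, by vertices known to be reachable.\<close>

lemma lightD:
  assumes "light G w S x" and "finite (gV G)"
    and "Y \<subseteq> gV G" and "\<And>y. y \<in> Y \<Longrightarrow> rch G (gV G - S) x y"
  shows "2 * sum w Y \<le> sum w (gV G)"
proof -
  have "sum w Y \<le> sum w {y \<in> gV G. rch G (gV G - S) x y}"
    using assms by (intro sum_mono2) auto
  then show ?thesis using assms(1) by (simp add: light_def)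
qed

lemma bal_sepD: "bal_sep G w S \<Longrightarrow> x \<in> gV G - S \<Longrightarrow> light G w S x"
  by (simp add: bal_sep_def)

text \<open>
  A tree decomposition, recorded by its set of bags only: starting from the root bag, each new bag
  meets the union of the previous ones inside a single previous bag.
\<close>

inductive td :: "'a set \<Rightarrow> 'a set set \<Rightarrow> bool" for R where
  root: "td R {R}"
| add: "td R \<B> \<Longrightarrow> X \<in> \<B> \<Longrightarrow> B \<inter> \<Union>\<B> \<subseteq> X \<Longrightarrow> td R (insert B \<B>)"

lemma td_finite: "td R \<B> \<Longrightarrow> finite \<B>"
  by (induction rule: td.induct) auto

lemma td_root_in: "td R \<B> \<Longrightarrow> R \<in> \<B>"
  by (induction rule: td.induct) auto

text \<open>The bags of the second decomposition are appended in their own order. Its root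
  \<open>Q\<close> is attached at \<open>X\<close>; a later bag meets the first decomposition only
  inside \<open>Q\<close>, which is covered by bags of the second already, so its old attachment bag
  still works.\<close>

lemma td_glue:
  assumes "td Q \<B>" and "td R \<A>" and "X \<in> \<A>"
    and "\<Union>\<A> \<inter> \<Union>\<B> \<subseteq> X" and "\<Union>\<A> \<inter> \<Union>\<B> \<subseteq> Q"
  shows "td R (\<A> \<union> \<B>)"
  using assms(1,4,5)
proof (induction rule: td.induct)
  case root
  have "td R (insert Q \<A>)"
    by (rule td.add[OF assms(2,3)]) (use root in auto)
  then show ?case by simp
next
  case (add \<B> Z B)
  have "td R (insert B (\<A> \<union> \<B>))"
  proof (rule td.add)
    show "td R (\<A> \<union> \<B>)" using add by blast
    show "Z \<in> \<A> \<union> \<B>" using add by blast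
    have "B \<inter> \<Union>\<A> \<subseteq> Q" "Q \<subseteq> \<Union>\<B>"
      using add.prems td_root_in[OF add.hyps(1)] by auto
    then show "B \<inter> \<Union>(\<A> \<union> \<B>) \<subseteq> Z" using add.hyps(3) by blast
  qed
  then show ?case by simp
qed

text \<open>
  The labelling \<open>f\<close> names the components left after deleting the bag \<open>Z\<close>. When a leaf bag is
  removed in the induction, its weight is moved to the bag it is attached to.
\<close>

lemma td_centroid:
  assumes "td R \<B>"
  shows "\<exists>Z\<in>\<B>. \<exists>f :: 'a \<Rightarrow> nat. (\<forall>Y\<in>\<B>. \<forall>u\<in>Y - Z. \<forall>v\<in>Y - Z. f u = f v) \<and>
    (\<forall>l. 2 * sum \<omega> {Y \<in> \<B>. \<exists>v \<in> Y - Z. f v = l} \<le> (sum \<omega> \<B> :: nat))"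
  using assms
proof (induction arbitrary: \<omega> rule: td.induct)
  case root
  have "{Y \<in> {R}. \<exists>v \<in> Y - R. 0 = l} = {}" for l :: nat by blast
  then show ?case
    by (intro bexI[of _ R] exI[of _ "\<lambda>_. 0"]) (simp_all only: sum.empty, auto)
next
  case (add \<B> X B)
  have fin: "finite \<B>" by (rule td_finite[OF add.hyps(1)])
  show ?case
  proof (cases "B \<in> \<B>")
    case True
    then show ?thesis using add.IH[of \<omega>] by (simp add: insert_absorb)
  next
    case new: False
    have tot: "sum \<omega> (insert B \<B>) = \<omega> B + sum \<omega> \<B>" using new fin by simp
    show ?thesis
    \<comment> \<open>A new bag with at least half of the total weight is itself a centroid: the
      other bags together weigh at most half, so a single label will do.\<close>
    proof (cases "2 * \<omega> B \<ge> sum \<omega> (insert B \<B>)")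
      case True
      have "2 * sum \<omega> {Y \<in> insert B \<B>. \<exists>v \<in> Y - B. (0::nat) = l} \<le> sum \<omega> (insert B \<B>)" for l
      proof -
        have "sum \<omega> {Y \<in> insert B \<B>. \<exists>v \<in> Y - B. (0::nat) = l} \<le> sum \<omega> \<B>"
          using fin by (intro sum_mono2) auto
        then show ?thesis using True tot by linarith
      qed
      then show ?thesis by (intro bexI[of _ B] exI[of _ "\<lambda>_. 0"]) auto
    next
      case False
      define \<omega>' where "\<omega>' = \<omega>(X := \<omega> X + \<omega> B)"
      have upd: "sum \<omega>' A = sum \<omega> A + (if X \<in> A then \<omega> B else 0)" if "finite A" for A
        using that by (auto simp: \<omega>'_def sum.remove[of A X] intro!: sum.cong)
      have tot': "sum \<omega>' \<B> = sum \<omega> (insert B \<B>)"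
        using upd[OF fin] add.hyps(2) tot by simp
      from add.IH[of \<omega>'] obtain Z f where Z: "Z \<in> \<B>"
        and f: "\<And>Y u v. Y \<in> \<B> \<Longrightarrow> u \<in> Y - Z \<Longrightarrow> v \<in> Y - Z \<Longrightarrow> f u = (f v :: nat)"
        and half: "\<And>l. 2 * sum \<omega>' {Y \<in> \<B>. \<exists>v \<in> Y - Z. f v = l} \<le> sum \<omega>' \<B>"
        by blast
      have le: "sum \<omega> A \<le> sum \<omega>' A" if "finite A" for A
        using upd[OF that] by simp
      show ?thesis
      proof (cases "B \<inter> \<Union>\<B> \<subseteq> Z")
        case True
        \<comment> \<open>Outside \<open>Z\<close> the bag \<open>B\<close> is disjoint from all
          earlier bags, so \<open>B - Z\<close> becomes a class of its own. It gets the label 0,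
          which the shift by \<open>Suc\<close> has freed.\<close>
        define f' where "f' v = (if v \<in> \<Union>\<B> then Suc (f v) else 0)" for v
        have const: "f' u = f' v" if "Y \<in> insert B \<B>" "u \<in> Y - Z" "v \<in> Y - Z" for Y u v
        proof (cases "Y = B")
          case True': True
          then have "u \<notin> \<Union>\<B>" "v \<notin> \<Union>\<B>" using that True by auto
          then show ?thesis by (simp add: f'_def)
        next
          case False
          then show ?thesis using that f[of Y u v] unfolding f'_def by auto
        qed
        have "2 * sum \<omega> {Y \<in> insert B \<B>. \<exists>v \<in> Y - Z. f' v = l} \<le> sum \<omega> (insert B \<B>)" for l
        proof (cases l)
          case 0
          have "{Y \<in> insert B \<B>. \<exists>v \<in> Y - Z. f' v = l} \<subseteq> {B}"
            using 0 by (auto simp: f'_def split: if_splits)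
          then have "sum \<omega> {Y \<in> insert B \<B>. \<exists>v \<in> Y - Z. f' v = l} \<le> sum \<omega> {B}"
            by (intro sum_mono2) auto
          then show ?thesis using \<open>\<not> 2 * \<omega> B \<ge> _\<close> by simp
        next
          case (Suc m)
          have "{Y \<in> insert B \<B>. \<exists>v \<in> Y - Z. f' v = l} \<subseteq> {Y \<in> \<B>. \<exists>v \<in> Y - Z. f v = m}"
            using Suc True by (auto simp: f'_def split: if_splits)
          then have "sum \<omega> {Y \<in> insert B \<B>. \<exists>v \<in> Y - Z. f' v = l} \<le> sum \<omega> {Y \<in> \<B>. \<exists>v \<in> Y - Z. f v = m}"
            using fin by (intro sum_mono2) auto
          also have "\<dots> \<le> sum \<omega>' {Y \<in> \<B>. \<exists>v \<in> Y - Z. f v = m}"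
            using fin by (intro le) auto
          finally show ?thesis using half[of m] tot' by linarith
        qed
        with const show ?thesis
          by (intro bexI[of _ Z] exI[of _ f'] conjI ballI allI) (assumption | simp add: Z)+
      next
        case False
        then obtain x where x: "x \<in> B" "x \<in> \<Union>\<B>" "x \<notin> Z" by blast
        then have xX: "x \<in> X" using add.hyps(3) by blast
        \<comment> \<open>\<open>B\<close> hangs on the component of \<open>x\<close>, so its new
          vertices inherit the label of \<open>x\<close>.\<close>
        define f' where "f' v = (if v \<in> \<Union>\<B> then f v else f x)" for v
        have B: "f' u = f x" if "u \<in> B - Z" for u
        proof (cases "u \<in> \<Union>\<B>")
          case True
          then have "u \<in> X" using that add.hyps(3) by blast
          then show ?thesis using f[OF add.hyps(2), of u x] that xX x True by (simp add: f'_def)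
        qed (auto simp: f'_def)
        have old: "f' u = f u" if "Y \<in> \<B>" "u \<in> Y" for Y u
          using that by (auto simp: f'_def)
        have const: "f' u = f' v" if "Y \<in> insert B \<B>" "u \<in> Y - Z" "v \<in> Y - Z" for Y u v
        proof (cases "Y = B")
          case True
          then show ?thesis using that B by simp
        next
          case False
          then have "Y \<in> \<B>" using that by blast
          then show ?thesis using that f[of Y u v] old by auto
        qed
        have "2 * sum \<omega> {Y \<in> insert B \<B>. \<exists>v \<in> Y - Z. f' v = l} \<le> sum \<omega> (insert B \<B>)" for l
        proof -
          let ?A = "{Y \<in> \<B>. \<exists>v \<in> Y - Z. f v = l}"
          have eq: "{Y \<in> \<B>. \<exists>v \<in> Y - Z. f' v = l} = ?A"
            using old by (metis (no_types, lifting) DiffD1)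
          have "sum \<omega> {Y \<in> insert B \<B>. \<exists>v \<in> Y - Z. f' v = l} \<le> sum \<omega>' ?A"
          \<comment> \<open>Only the class of \<open>x\<close> gains the bag \<open>B\<close>. It
            also contains \<open>X\<close>, to which the weight of \<open>B\<close> was moved, so
            the gain is already counted in \<open>\<omega>'\<close>.\<close>
          proof (cases "l = f x")
            case True
            have "{Y \<in> insert B \<B>. \<exists>v \<in> Y - Z. f' v = l} \<subseteq> insert B ?A"
              using eq by blast
            then have "sum \<omega> {Y \<in> insert B \<B>. \<exists>v \<in> Y - Z. f' v = l} \<le> sum \<omega> (insert B ?A)"
              using fin by (intro sum_mono2) auto
            also have "\<dots> = \<omega> B + sum \<omega> ?A" using fin new by simp
            also have "\<dots> = sum \<omega>' ?A"
              using upd[of ?A] fin add.hyps(2) xX x True by auto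
            finally show ?thesis .
          next
            case False
            have "{Y \<in> insert B \<B>. \<exists>v \<in> Y - Z. f' v = l} \<subseteq> ?A"
              using eq B False by blast
            then have "sum \<omega> {Y \<in> insert B \<B>. \<exists>v \<in> Y - Z. f' v = l} \<le> sum \<omega> ?A"
              using fin by (intro sum_mono2) auto
            also have "\<dots> \<le> sum \<omega>' ?A" using fin by (intro le) auto
            finally show ?thesis .
          qed
          then show ?thesis using half[of l] tot' by linarith
        qed
        with const show ?thesis
          by (intro bexI[of _ Z] exI[of _ f'] conjI ballI allI) (assumption | simp add: Z)+
      qed
    qed
  qed
qed

section \<open>Tree decompositions\<close>

inductive ltree :: "'a set \<Rightarrow> 'a set set \<Rightarrow> bool" where
  single: "ltree {r} {}"
| leaf: "ltree V E \<Longrightarrow> p \<in> V \<Longrightarrow> l \<notin> V \<Longrightarrow> ltree (insert l V) (insert {l, p} E)"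

lemma ltree_props:
  "ltree V E \<Longrightarrow> finite V \<and> finite E \<and> card V = card E + 1 \<and> (\<forall>e\<in>E. e \<subseteq> V)"
proof (induction rule: ltree.induct)
  case (leaf V E p l)
  then have "{l, p} \<notin> E" by blast
  then show ?case using leaf by auto
qed simp

text \<open>Connectivity lets a subtree grow until it has all vertices. It then has one edge less
  than vertices, which by the count in \<open>is_tree\<close> is all of \<open>gE T\<close>; no
  cycle argument is required.\<close>

lemma is_tree_imp_ltree:
  assumes "is_tree T"
  shows "ltree (gV T) (gE T)"
proof -
  let ?V = "gV T" and ?E = "gE T"
  have wf: "wf_graph T" and con: "connected_graph T" and cd: "card ?E + 1 = card ?V"
    using assms by (auto simp: is_tree_def)
  have finV: "finite ?V" using wf by (rule wf_finite)
  have "?E \<subseteq> Pow ?V" using wf by (auto simp: wf_graph_def)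
  then have finE: "finite ?E" using finV by (meson finite_Pow_iff finite_subset)
  have "\<exists>A F. ltree A F \<and> A \<subseteq> ?V \<and> F \<subseteq> ?E \<and> card A = Suc n" if "Suc n \<le> card ?V" for n
    using that
  proof (induction n)
    case 0
    from con obtain r where "r \<in> ?V" by (auto simp: connected_graph_def)
    then show ?case by (intro exI[of _ "{r}"] exI[of _ "{}"]) (auto intro: ltree.single)
  next
    case (Suc n)
    then obtain A F where A: "ltree A F" "A \<subseteq> ?V" "F \<subseteq> ?E" "card A = Suc n" by auto
    then obtain a where a: "a \<in> A" by fastforce
    have "A \<noteq> ?V" using A(4) Suc.prems by auto
    then obtain b where b: "b \<in> ?V" "b \<notin> A" using A(2) by blast
    have "\<exists>u v. u \<in> A \<and> v \<notin> A \<and> {u, v} \<in> ?E"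
    proof (rule ccontr)
      assume no: "\<not> ?thesis"
      have "rch T ?V a b"
        using con a b(1) A(2) reach_iff_rch[OF wf] by (auto simp: connected_graph_def)
      then have "b \<in> A" by (rule rch_closed) (use a no in auto)
      then show False using b(2) by simp
    qed
    then obtain u v where uv: "u \<in> A" "v \<notin> A" "{u, v} \<in> ?E" by blast
    have "ltree (insert v A) (insert {v, u} F)" using A(1) uv(1,2) by (rule ltree.leaf)
    moreover have "v \<in> ?V" using wf_edge[OF wf uv(3)] by simp
    moreover have "card (insert v A) = Suc (Suc n)"
      using A uv(2) finV by (simp add: finite_subset)
    ultimately show ?case
      using A uv(3) by (intro exI[of _ "insert v A"] exI[of _ "insert {v, u} F"]) (auto simp: insert_commute)
  qed
  from this[of "card ?E"] cd obtain A F where A: "ltree A F" "A \<subseteq> ?V" "F \<subseteq> ?E" "card A = card ?V"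
    by auto
  have "A = ?V" using A finV by (simp add: card_subset_eq)
  moreover have "F = ?E"
    using ltree_props[OF A(1)] A cd finE by (intro card_subset_eq) auto
  ultimately show ?thesis using A(1) by simp
qed

text \<open>A walk can enter and leave \<open>l\<close> only through \<open>p\<close>, so visits to
  \<open>l\<close> can be cut out. The case \<open>t = l\<close> is part of the claim because the
  induction passes through walks ending at \<open>l\<close>.\<close>

lemma rch_remove_leaf:
  assumes "rch (insert l V, insert {l, p} E) X s t" and "s \<noteq> l" and "p \<noteq> l"
    and "\<And>e. e \<in> E \<Longrightarrow> l \<notin> e"
  shows "if t = l then p \<in> X \<and> rch (V, E) (X - {l}) s p else rch (V, E) (X - {l}) s t"
  using assms(1)
proof (induction rule: rch_induct)
  case base
  then show ?case using assms(2) by simp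
next
  case (step u v)
  then consider "{u, v} \<in> E" | "u = l" "v = p" | "u = p" "v = l"
    by (auto simp: gE_def doubleton_eq_iff)
  then show ?case
  proof cases
    case 1
    then have "u \<noteq> l" "v \<noteq> l" using assms(4) by blast+
    moreover have "rch (V, E) (X - {l}) u v"
      using 1 step calculation by (intro rch_step) (auto simp: gE_def)
    ultimately show ?thesis using step(1) by (auto intro: rch_trans)
  qed (use step(1,4,5) assms(3) in auto)
qed

text \<open>A vertex shared by the leaf bag and an earlier bag lies in all bags along a walk from
  that bag to the leaf, and such a walk passes through \<open>p\<close>. Hence \<open>B p\<close> is
  a valid attachment bag.\<close>

lemma ltree_imp_td:
  assumes "ltree V E"
    and "\<And>v s t. s \<in> V \<Longrightarrow> t \<in> V \<Longrightarrow> v \<in> B s \<Longrightarrow> v \<in> B t \<Longrightarrow> rch (V, E) {t \<in> V. v \<in> B t} s t"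
  shows "\<exists>R. td R (B ` V)"
  using assms
proof (induction rule: ltree.induct)
  case (single r)
  then show ?case by (auto intro: td.root)
next
  case (leaf V E p l)
  have E: "\<And>e. e \<in> E \<Longrightarrow> l \<notin> e" using ltree_props[OF leaf.hyps(1)] leaf.hyps(3) by blast
  have pl: "p \<noteq> l" using leaf.hyps by blast
  have "\<exists>R. td R (B ` V)"
  proof (rule leaf.IH)
    fix v s t assume *: "s \<in> V" "t \<in> V" "v \<in> B s" "v \<in> B t"
    have "rch (insert l V, insert {l, p} E) {t \<in> insert l V. v \<in> B t} s t"
      using * by (intro leaf.prems) auto
    moreover have "s \<noteq> l" "t \<noteq> l" using * leaf.hyps by auto
    ultimately have "rch (V, E) ({t \<in> insert l V. v \<in> B t} - {l}) s t"
      using rch_remove_leaf[OF _ _ pl E] by metis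
    then show "rch (V, E) {t \<in> V. v \<in> B t} s t" by (rule rch_mono) auto
  qed
  then obtain R where R: "td R (B ` V)" by blast
  have "B l \<inter> \<Union>(B ` V) \<subseteq> B p"
  proof safe
    fix v t assume *: "v \<in> B l" "v \<in> B t" "t \<in> V"
    have "rch (insert l V, insert {l, p} E) {t \<in> insert l V. v \<in> B t} t l"
      using * by (intro leaf.prems) auto
    moreover have "t \<noteq> l" using * leaf.hyps by auto
    ultimately show "v \<in> B p" using rch_remove_leaf[OF _ _ pl E] by fastforce
  qed
  then have "td R (insert (B l) (B ` V))" using R leaf.hyps by (intro td.add[of _ _ "B p"]) auto
  then show ?case by auto
qed

lemma tree_decomp_imp_td:
  assumes "tree_decomp G T B"
  shows "\<exists>R. td R (B ` gV T)"
proof (rule ltree_imp_td)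
  have td: "is_tree T" "\<And>t. t \<in> gV T \<Longrightarrow> B t \<subseteq> gV G"
    "\<And>v. v \<in> gV G \<Longrightarrow> connected_graph (induced T {t \<in> gV T. v \<in> B t})"
    using assms by (auto simp: tree_decomp_def)
  show "ltree (gV T) (gE T)" using td(1) by (rule is_tree_imp_ltree)
  fix v s t assume *: "s \<in> gV T" "t \<in> gV T" "v \<in> B s" "v \<in> B t"
  then have "v \<in> gV G" using td(2) by blast
  from td(3)[OF this] have "rch T {t \<in> gV T. v \<in> B t} s t"
    using * by (subst (asm) connected_induced_iff) auto
  then show "rch (gV T, gE T) {t \<in> gV T. v \<in> B t} s t" by (simp add: gV_def gE_def)
qed

text \<open>Every vertex is charged to one bag containing it, so the bag weights add up to the
  total, and a centroid bag is the separator. Each edge lies in a bag, on which the centroid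
  labelling is constant off \<open>Z\<close>; so a component of the rest stays in one label class,
  and all its vertices are charged to bags of that class.\<close>

lemma wsep_if_bags:
  assumes td: "td R \<B>" and un: "\<Union>\<B> = gV G" and fin: "finite (gV G)"
    and edge: "\<And>e. e \<in> gE G \<Longrightarrow> \<exists>Y\<in>\<B>. e \<subseteq> Y" and card: "\<And>Y. Y \<in> \<B> \<Longrightarrow> card Y \<le> s"
  shows "wsep s G"
  unfolding wsep_def
proof
  fix w :: "'a \<Rightarrow> nat"
  have "\<forall>v\<in>gV G. \<exists>Y\<in>\<B>. v \<in> Y" using un by blast
  then obtain h where h: "\<And>v. v \<in> gV G \<Longrightarrow> h v \<in> \<B> \<and> v \<in> h v" by metis
  define \<omega> where "\<omega> Y = sum w {v \<in> gV G. h v = Y}" for Y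
  have finB: "finite \<B>" by (rule td_finite[OF td])
  have tot: "sum \<omega> \<B> = sum w (gV G)"
    unfolding \<omega>_def using fin finB h by (intro sum.group) auto
  from td_centroid[OF td, of \<omega>] obtain Z and f :: "'a \<Rightarrow> nat" where Z: "Z \<in> \<B>"
    and f: "\<And>Y u v. Y \<in> \<B> \<Longrightarrow> u \<in> Y - Z \<Longrightarrow> v \<in> Y - Z \<Longrightarrow> f u = f v"
    and half: "\<And>l. 2 * sum \<omega> {Y \<in> \<B>. \<exists>v \<in> Y - Z. f v = l} \<le> sum \<omega> \<B>"
    by blast
  have "bal_sep G w Z"
    unfolding bal_sep_def
  proof (intro conjI ballI)
    show "Z \<subseteq> gV G" using Z un by blast
    fix x assume x: "x \<in> gV G - Z"
    let ?Y = "{y \<in> gV G - Z. f y = f x}"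
    let ?A = "{Y \<in> \<B>. \<exists>v \<in> Y - Z. f v = f x}"
    have "sum w ?Y = (\<Sum>Y\<in>?A. sum w {v \<in> ?Y. h v = Y})"
      using fin finB h by (intro sum.group[symmetric]) auto
    also have "\<dots> \<le> sum \<omega> ?A"
      unfolding \<omega>_def using fin by (intro sum_mono sum_mono2) auto
    finally have le: "2 * sum w ?Y \<le> sum w (gV G)" using half[of "f x"] tot by linarith
    show "light G w Z x"
    proof (rule lightI[OF fin _ _ _ le])
      fix u v assume uv: "u \<in> ?Y" "v \<in> gV G" "v \<notin> Z" "{u, v} \<in> gE G"
      from edge[OF uv(4)] obtain Y where "Y \<in> \<B>" "{u, v} \<subseteq> Y" by blast
      then show "v \<in> ?Y" using f[of Y u v] uv by auto
    qed (use x in auto)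
  qed
  then show "\<exists>S. bal_sep G w S \<and> card S \<le> s" using card[OF Z] by blast
qed

lemma is_tree_single: "is_tree ({r}, {})"
  by (auto simp: is_tree_def wf_graph_def connected_graph_def reach_def gV_def gE_def)

text \<open>The one-bag decomposition shows that some width is attained, which is what the
  \<open>LEAST\<close> in \<open>treewidth\<close> asks for.\<close>

lemma treewidth_decomp:
  assumes "wf_graph G"
  shows "\<exists>T B. tree_decomp G T B \<and> (\<forall>t\<in>gV T. card (B t) \<le> treewidth G + 1)"
  unfolding treewidth_def
proof (rule LeastI[of _ "card (gV G)"], intro exI conjI)
  let ?T = "({0}, {}) :: nat graph"
  have "is_tree ?T" by (rule is_tree_single)
  moreover have "connected_graph (induced ?T {t \<in> gV ?T. v \<in> gV G})" if "v \<in> gV G" for v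
    using that by (subst connected_induced_iff) (auto simp: gV_def)
  moreover have "e \<subseteq> gV G" if "e \<in> gE G" for e
    using assms that by (auto simp: wf_graph_def)
  ultimately show "tree_decomp G ?T (\<lambda>_. gV G)"
    unfolding tree_decomp_def by (auto simp: gV_def)
qed simp

lemma treewidth_imp_wsep:
  assumes wf: "wf_graph G" and "treewidth G \<le> k"
  shows "wsep (k + 1) G"
proof -
  obtain T B where TB: "tree_decomp G T B" "\<And>t. t \<in> gV T \<Longrightarrow> card (B t) \<le> treewidth G + 1"
    using treewidth_decomp[OF wf] by blast
  have bags: "\<And>t. t \<in> gV T \<Longrightarrow> B t \<subseteq> gV G" "\<And>v. v \<in> gV G \<Longrightarrow> \<exists>t\<in>gV T. v \<in> B t"
    "\<And>e. e \<in> gE G \<Longrightarrow> \<exists>t\<in>gV T. e \<subseteq> B t"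
    using TB(1) unfolding tree_decomp_def by (elim conjE, metis)+
  obtain R where "td R (B ` gV T)" using tree_decomp_imp_td[OF TB(1)] by blast
  then show ?thesis
  proof (rule wsep_if_bags)
    show "\<Union>(B ` gV T) = gV G" using bags(1,2) by blast
    show "finite (gV G)" by (rule wf_finite[OF wf])
    show "\<exists>Y\<in>B ` gV T. e \<subseteq> Y" if "e \<in> gE G" for e
      using bags(3)[OF that] by blast
    fix Y assume "Y \<in> B ` gV T"
    then obtain t where "t \<in> gV T" "Y = B t" by blast
    then show "card Y \<le> k + 1" using TB(2)[of t] assms(2) by simp
  qed
qed

section \<open>From bags back to a tree decomposition\<close>

lemma is_tree_add_leaf:
  assumes T: "is_tree T" and p: "p \<in> gV T" and l: "l \<notin> gV T"
  shows "is_tree (insert l (gV T), insert {l, p} (gE T))" (is "is_tree ?T")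
proof -
  have wf: "wf_graph T" and con: "connected_graph T" and cd: "card (gE T) + 1 = card (gV T)"
    using T by (auto simp: is_tree_def)
  have V: "gV ?T = insert l (gV T)" and E: "gE ?T = insert {l, p} (gE T)"
    by (auto simp: gV_def gE_def)
  have wf': "wf_graph ?T"
    unfolding wf_graph_def V E using wf p l by (fastforce simp: wf_graph_def)
  have r: "rch ?T (gV ?T) u p" if "u \<in> gV ?T" for u
  proof (cases "u = l")
    case True
    then show ?thesis using p by (intro rch_step) (auto simp: V E)
  next
    case False
    then have "rch T (gV T) u p"
      using that con p reach_iff_rch[OF wf] by (auto simp: connected_graph_def V)
    then show ?thesis by (rule rch_map[where h = "\<lambda>x. x"]) (auto simp: V E)
  qed
  have "connected_graph ?T"
    unfolding connected_graph_def reach_iff_rch[OF wf'] using r rch_sym rch_trans V by (metis insert_not_empty)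
  moreover have "card (gE ?T) + 1 = card (gV ?T)"
  proof -
    have "{l, p} \<notin> gE T" using wf_edge(1)[OF wf] l by blast
    moreover have "finite (gE T)"
      using wf by (intro finite_subset[of "gE T" "Pow (gV T)"]) (auto simp: wf_graph_def)
    ultimately show ?thesis using cd l wf_finite[OF wf] by (simp add: V E)
  qed
  ultimately show ?thesis using wf' by (simp add: is_tree_def)
qed

text \<open>Each added bag becomes a leaf at a node carrying its attachment bag. \<open>td\<close>
  may add a bag that is already there, so the same bag may sit at several nodes and only the image
  of \<open>B\<close> is prescribed.\<close>

lemma td_imp_tree:
  assumes "td R \<B>"
  shows "\<exists>(T :: nat graph) B. is_tree T \<and> B ` gV T = \<B> \<and>
    (\<forall>v. \<forall>s\<in>gV T. \<forall>t\<in>gV T. v \<in> B s \<longrightarrow> v \<in> B t \<longrightarrow> rch T {t \<in> gV T. v \<in> B t} s t)"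
  using assms
proof (induction rule: td.induct)
  case root
  have "gV ({0}, {}) = {0 :: nat}" by (simp add: gV_def)
  then show ?case
    using is_tree_single by (intro exI[of _ "({0}, {})"] exI[of _ "\<lambda>_. R"]) simp
next
  case (add \<B> X C)
  from add.IH obtain T :: "nat graph" and B where T: "is_tree T" "B ` gV T = \<B>"
    "\<And>v s t. s \<in> gV T \<Longrightarrow> t \<in> gV T \<Longrightarrow> v \<in> B s \<Longrightarrow> v \<in> B t \<Longrightarrow> rch T {t \<in> gV T. v \<in> B t} s t"
    by blast
  from T(2) add.hyps(2) obtain p where p: "p \<in> gV T" "B p = X" by blast
  have "finite (gV T)" using T(1) by (simp add: is_tree_def wf_graph_def)
  then obtain l where l: "l \<notin> gV T" using ex_new_if_finite infinite_UNIV_nat by blast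
  let ?T = "(insert l (gV T), insert {l, p} (gE T))"
  have V: "gV ?T = insert l (gV T)" and E: "gE ?T = insert {l, p} (gE T)"
    by (auto simp: gV_def gE_def)
  define D where "D = B(l := C)"
  have D: "D t = B t" if "t \<in> gV T" for t using that l by (auto simp: D_def)
  have Dl: "D l = C" by (simp add: D_def)
  have old: "rch ?T {t \<in> gV ?T. v \<in> D t} s t"
    if "s \<in> gV T" "t \<in> gV T" "v \<in> D s" "v \<in> D t" for v s t
  proof -
    have "rch T {t \<in> gV T. v \<in> B t} s t" using that D by (intro T(3)) auto
    then show ?thesis by (rule rch_map[where h = "\<lambda>x. x"]) (auto simp: V E D)
  qed
  have new: "rch ?T {t \<in> gV ?T. v \<in> D t} s l" if "s \<in> gV T" "v \<in> D s" "v \<in> D l" for v s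
  proof -
    have "v \<in> X" using that D T(2) add.hyps(3) Dl by blast
    then have vp: "v \<in> D p" using p D by simp
    then have "rch ?T {t \<in> gV ?T. v \<in> D t} s p" using that p by (intro old) auto
    moreover have "rch ?T {t \<in> gV ?T. v \<in> D t} p l"
      using vp that p by (intro rch_step) (auto simp: V E insert_commute)
    ultimately show ?thesis by (rule rch_trans)
  qed
  have "rch ?T {t \<in> gV ?T. v \<in> D t} s t"
    if "s \<in> gV ?T" "t \<in> gV ?T" "v \<in> D s" "v \<in> D t" for v s t
    using that old[of s t v] new[of s v] rch_sym[OF new[of t v]] V by (cases "s = l"; cases "t = l") auto
  moreover have "D ` gV ?T = insert C \<B>" using T(2) D Dl by (auto simp: V)
  moreover have "is_tree ?T" using T(1) p(1) l by (rule is_tree_add_leaf)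
  ultimately show ?case by blast
qed

lemma treewidth_le_if_bags:
  assumes td: "td R \<B>" and un: "\<Union>\<B> = gV G"
    and edge: "\<And>e. e \<in> gE G \<Longrightarrow> \<exists>Y\<in>\<B>. e \<subseteq> Y" and card: "\<And>Y. Y \<in> \<B> \<Longrightarrow> card Y \<le> k + 1"
  shows "treewidth G \<le> k"
  unfolding treewidth_def
proof (rule Least_le)
  obtain T :: "nat graph" and B where T: "is_tree T" "B ` gV T = \<B>"
    "\<And>v s t. s \<in> gV T \<Longrightarrow> t \<in> gV T \<Longrightarrow> v \<in> B s \<Longrightarrow> v \<in> B t \<Longrightarrow> rch T {t \<in> gV T. v \<in> B t} s t"
    using td_imp_tree[OF td] by blast
  have "connected_graph (induced T {t \<in> gV T. v \<in> B t})" if "v \<in> gV G" for v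
    using that T un by (subst connected_induced_iff) auto
  then have "tree_decomp G T B"
    unfolding tree_decomp_def using T(1,2) un edge by blast
  then show "\<exists>T B. tree_decomp G T B \<and> (\<forall>t\<in>gV T. card (B t) \<le> k + 1)"
    using card T(2) by (intro exI[of _ T] exI[of _ B]) auto
qed

section \<open>From balanced separators to bags\<close>

lemma sum_indicator_card:
  assumes "finite A"
  shows "sum (\<lambda>v. if v \<in> W then 1 else 0 :: nat) A = card (A \<inter> W)"
  using assms by (simp add: sum.If_cases)

text \<open>
  The root bag consists of a balanced separator of \<open>W\<close>, enlarged to exactly \<open>2 * s + 2\<close> vertices,
  together with that set; the recursion descends to each component with the separator added.
\<close>

lemma wsep_imp_bags:
  assumes fin: "finite (gV G)" and sep: "wsep s G"
    and "U \<subseteq> gV G" and "W \<subseteq> U" and "card W \<le> 2 * s + 2"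
  shows "\<exists>R \<B>. td R \<B> \<and> W \<subseteq> R \<and> \<Union>\<B> = U \<and> (\<forall>Y\<in>\<B>. card Y \<le> 3 * s + 2) \<and>
    (\<forall>u\<in>U. \<forall>v\<in>U. {u, v} \<in> gE G \<longrightarrow> (\<exists>Y\<in>\<B>. {u, v} \<subseteq> Y))"
  using assms(3-5)
proof (induction "card U" arbitrary: U W rule: less_induct)
  case less
  have finU: "finite U" using less.prems(1) fin by (rule finite_subset)
  show ?case
  proof (cases "card U \<le> 2 * s + 2")
    case True
    then show ?thesis
      using less.prems by (intro exI[of _ U] exI[of _ "{U}"]) (auto intro: td.root)
  next
    case False
    \<comment> \<open>With exactly \<open>2 * s + 2\<close> marked vertices, half of them is
      \<open>s + 1\<close>. A component with the separator added then holds at most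
      \<open>2 * s + 1\<close> marked vertices, so it misses one and the recursion makes progress.
      The root bag has at most \<open>(2 * s + 2) + s\<close> vertices.\<close>
    then obtain W' where W': "W \<subseteq> W'" "W' \<subseteq> U" "card W' = 2 * s + 2"
      using exists_subset_between[of W "2 * s + 2" U] less.prems finU by auto
    have finW: "finite W'" using W'(2) finU by (rule finite_subset)
    define w where "w v = (if v \<in> W' then 1 else 0 :: nat)" for v
    have w: "sum w A = card (A \<inter> W')" if "finite A" for A
      unfolding w_def using that by (rule sum_indicator_card)
    from sep obtain S0 where S0: "bal_sep G w S0" "card S0 \<le> s"
      unfolding wsep_def by blast
    \<comment> \<open>The separator is taken in all of \<open>G\<close>, and only its part inside
      \<open>U\<close> is kept: components of \<open>U - S\<close> lie within components of
      \<open>G\<close> minus \<open>S0\<close>.\<close>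
    define S where "S = S0 \<inter> U"
    have "S0 \<subseteq> gV G" using S0(1) by (simp add: bal_sep_def)
    then have cS: "card S \<le> s" 
      unfolding S_def using S0(2) fin
      by (meson card_mono finite_subset inf_le1 le_trans)
    have SU: "S \<subseteq> U" by (simp add: S_def)
    define K where "K x = {y \<in> U. rch G (U - S) x y}" for x
    have K_self: "x \<in> K x" if "x \<in> U - S" for x using that by (simp add: K_def)
    have K_sub: "K x \<subseteq> U - S" if "x \<in> U - S" for x
      using that rch_in[of G "U - S" x] by (auto simp: K_def)
    have K_eq: "K x = K y" if "z \<in> K x" "z \<in> K y" for x y z
    proof -
      have "rch G (U - S) x y" using that rch_sym rch_trans unfolding K_def by fast
      then have "rch G (U - S) x v \<longleftrightarrow> rch G (U - S) y v" for v
        using rch_sym rch_trans by fast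
      then show ?thesis by (simp add: K_def)
    qed
    have K_card: "card (K x \<inter> W') \<le> s + 1" if "x \<in> U - S" for x
    proof -
      have "2 * sum w (K x) \<le> sum w (gV G)"
      proof (rule lightD[OF bal_sepD[OF S0(1)] fin])
        show "x \<in> gV G - S0" using that less.prems(1) by (auto simp: S_def)
        show "K x \<subseteq> gV G" using less.prems(1) by (auto simp: K_def)
        show "rch G (gV G - S0) x y" if "y \<in> K x" for y
          using that less.prems(1) unfolding K_def S_def by (auto intro: rch_mono)
      qed
      moreover have "sum w (gV G) = 2 * s + 2"
      proof -
        have "gV G \<inter> W' = W'" using W'(2) less.prems(1) by auto
        then show ?thesis using w[OF fin] W'(3) by simp
      qed
      moreover have "sum w (K x) = card (K x \<inter> W')"
        using finU by (intro w) (auto simp: K_def)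
      ultimately show ?thesis by simp
    qed
    \<comment> \<open>The decompositions of the components are attached to the root bag one at a
      time. A new one meets the union of the previous ones only in
      \<open>W' \<inter> C \<union> S\<close>, which is contained both in its own root and in the
      common root bag.\<close>
    have glue: "\<exists>\<B>. td (W' \<union> S) \<B> \<and> \<Union>\<B> = W' \<union> S \<union> \<Union>F \<and> (\<forall>Y\<in>\<B>. card Y \<le> 3 * s + 2) \<and>
      (\<forall>C\<in>F. \<forall>u\<in>C \<union> S. \<forall>v\<in>C \<union> S. {u, v} \<in> gE G \<longrightarrow> (\<exists>Y\<in>\<B>. {u, v} \<subseteq> Y))"
      if "finite F" "F \<subseteq> K ` (U - S)" for F
      using that
    proof (induction rule: finite_induct)
      case empty
      have "card (W' \<union> S) \<le> 3 * s + 2"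
        using card_Un_le[of W' S] W'(3) cS by simp
      then show ?case by (intro exI[of _ "{W' \<union> S}"]) (auto intro: td.root)
    next
      case (insert C F)
      then obtain x where x: "x \<in> U - S" "C = K x" by blast
      from insert obtain \<A> where A: "td (W' \<union> S) \<A>" "\<Union>\<A> = W' \<union> S \<union> \<Union>F"
        "\<And>Y. Y \<in> \<A> \<Longrightarrow> card Y \<le> 3 * s + 2"
        "\<And>C u v. C \<in> F \<Longrightarrow> u \<in> C \<union> S \<Longrightarrow> v \<in> C \<union> S \<Longrightarrow> {u, v} \<in> gE G \<Longrightarrow> \<exists>Y\<in>\<A>. {u, v} \<subseteq> Y"
        by auto
      have CU: "C \<subseteq> U - S" using K_sub x by simp
      have disj: "C \<inter> \<Union>F = {}"
      proof (rule ccontr)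
        assume "C \<inter> \<Union>F \<noteq> {}"
        then obtain z D where z: "z \<in> C" "z \<in> D" "D \<in> F" by blast
        then obtain y where "D = K y" using insert.prems by blast
        then have "C = D" using K_eq z x(2) by blast
        then show False using z(3) insert.hyps(2) by simp
      qed
      have cC: "card (W' \<inter> C) \<le> s + 1" using K_card x by (simp add: Int_commute)
      have "card (W' \<inter> (C \<union> S)) < card W'"
      proof -
        have "card (W' \<inter> (C \<union> S)) \<le> card (W' \<inter> C \<union> S)"
          using finU SU finW by (intro card_mono) (auto intro: finite_subset)
        also have "\<dots> \<le> card (W' \<inter> C) + card S" by (rule card_Un_le)
        finally show ?thesis using cC cS W'(3) by simp
      qed
      then have "\<not> W' \<subseteq> C \<union> S" using inf_absorb1 by fastforce
      then have "C \<union> S \<subset> U" using CU SU W'(2) by blast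
      then have lt: "card (C \<union> S) < card U" using finU by (rule psubset_card_mono[rotated])
      have "card (W' \<inter> C \<union> S) \<le> 2 * s + 2"
        using card_Un_le[of "W' \<inter> C" S] cC cS by simp
      moreover have "C \<union> S \<subseteq> gV G" "W' \<inter> C \<union> S \<subseteq> C \<union> S" using CU SU less.prems(1) by auto
      ultimately obtain R \<B> where B: "td R \<B>" "W' \<inter> C \<union> S \<subseteq> R" "\<Union>\<B> = C \<union> S"
        "\<And>Y. Y \<in> \<B> \<Longrightarrow> card Y \<le> 3 * s + 2"
        "\<And>u v. u \<in> C \<union> S \<Longrightarrow> v \<in> C \<union> S \<Longrightarrow> {u, v} \<in> gE G \<Longrightarrow> \<exists>Y\<in>\<B>. {u, v} \<subseteq> Y"
        using less.hyps[OF lt, of "W' \<inter> C \<union> S"] by auto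
      have cut: "\<Union>\<A> \<inter> \<Union>\<B> \<subseteq> W' \<inter> C \<union> S" using A(2) B(3) disj by blast
      have 1: "td (W' \<union> S) (\<A> \<union> \<B>)"
        by (rule td_glue[OF B(1) A(1) td_root_in[OF A(1)]]) (use cut B(2) in auto)
      have 2: "\<Union>(\<A> \<union> \<B>) = W' \<union> S \<union> \<Union>(insert C F)" using A(2) B(3) by auto
      have 3: "card Y \<le> 3 * s + 2" if "Y \<in> \<A> \<union> \<B>" for Y using that A(3) B(4) by blast
      have "\<exists>Y\<in>\<A> \<union> \<B>. {u, v} \<subseteq> Y"
        if "D \<in> insert C F" "u \<in> D \<union> S" "v \<in> D \<union> S" "{u, v} \<in> gE G" for D u v
      proof (cases "D = C")
        case True
        then show ?thesis using B(5)[of u v] that by blast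
      next
        case False
        then show ?thesis using A(4)[of D u v] that by blast
      qed
      with 1 2 3 show ?case by (intro exI[of _ "\<A> \<union> \<B>"] conjI ballI impI) assumption+
    qed
    have "finite (K ` (U - S))" using finU by simp
    from glue[OF this subset_refl] obtain \<B> where B: "td (W' \<union> S) \<B>"
      "\<Union>\<B> = W' \<union> S \<union> \<Union>(K ` (U - S))" "\<forall>Y\<in>\<B>. card Y \<le> 3 * s + 2"
      and edges: "\<forall>C\<in>K ` (U - S). \<forall>u\<in>C \<union> S. \<forall>v\<in>C \<union> S. {u, v} \<in> gE G \<longrightarrow> (\<exists>Y\<in>\<B>. {u, v} \<subseteq> Y)"
      by (elim exE conjE)
    have B4: "\<exists>Y\<in>\<B>. {u, v} \<subseteq> Y"
      if "x \<in> U - S" "u \<in> K x \<union> S" "v \<in> K x \<union> S" "{u, v} \<in> gE G" for x u v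
      using edges[rule_format, OF imageI[OF that(1)] that(2-4)] .
    have un: "\<Union>\<B> = U" using B(2) K_self K_sub W'(2) SU by blast
    have "\<exists>Y\<in>\<B>. {u, v} \<subseteq> Y" if uv: "u \<in> U" "v \<in> U" "{u, v} \<in> gE G" for u v
    proof -
      have nb: "y \<in> K x \<union> S" if "x \<in> U - S" "y \<in> U" "{x, y} \<in> gE G" for x y
        using that by (auto simp: K_def intro: rch_step)
      consider "u \<in> S" "v \<in> S" | "u \<in> U - S" | "v \<in> U - S" using uv by blast
      then show ?thesis
      proof cases
        case 1
        then show ?thesis using td_root_in[OF B(1)] by blast
      next
        case 2
        then show ?thesis using B4[of u u v] nb[of u v] uv K_self by blast
      next
        case 3
        then have "u \<in> K v \<union> S" using nb[of v u] uv by (simp add: insert_commute)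
        then show ?thesis using B4[of v u v] 3 uv K_self by blast
      qed
    qed
    moreover have "W \<subseteq> W' \<union> S" using W'(1) by blast
    ultimately show ?thesis
      using B(1,3) un by (intro exI[of _ "W' \<union> S"] exI[of _ \<B>] conjI ballI impI) (assumption | simp)+
  qed
qed

lemma wsep_imp_treewidth:
  assumes wf: "wf_graph G" and sep: "wsep s G"
  shows "treewidth G \<le> 3 * s + 2"
proof -
  obtain R \<B> where B: "td R \<B>" "\<Union>\<B> = gV G" "\<And>Y. Y \<in> \<B> \<Longrightarrow> card Y \<le> 3 * s + 2"
    "\<And>u v. u \<in> gV G \<Longrightarrow> v \<in> gV G \<Longrightarrow> {u, v} \<in> gE G \<Longrightarrow> \<exists>Y\<in>\<B>. {u, v} \<subseteq> Y"
    using wsep_imp_bags[OF wf_finite[OF wf] sep, of "gV G" "{}"] by auto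
  show ?thesis
  proof (rule treewidth_le_if_bags[OF B(1,2)])
    show "\<exists>Y\<in>\<B>. e \<subseteq> Y" if "e \<in> gE G" for e
      using that wf B(4) unfolding wf_graph_def by metis
    show "card Y \<le> 3 * s + 2 + 1" if "Y \<in> \<B>" for Y using B(3)[OF that] by simp
  qed
qed

text \<open>The two directions replace \<open>k\<close> by \<open>k + 1\<close> and \<open>s\<close>
  by \<open>3 * s + 2\<close>, and boundedness does not see this. From here on treewidth enters only
  through \<open>wsep\<close>.\<close>

lemma bounded_treewidth_iff_wsep:
  assumes "\<And>G. G \<in> C \<Longrightarrow> wf_graph G"
  shows "bounded_param treewidth C \<longleftrightarrow> (\<exists>s. \<forall>G\<in>C. wsep s G)"
proof
  assume "bounded_param treewidth C"
  then obtain k where k: "\<And>G. G \<in> C \<Longrightarrow> treewidth G \<le> k" unfolding bounded_param_def by blast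
  have "wsep (k + 1) G" if "G \<in> C" for G
    using assms[OF that] k[OF that] by (rule treewidth_imp_wsep)
  then show "\<exists>s. \<forall>G\<in>C. wsep s G" by blast
next
  assume "\<exists>s. \<forall>G\<in>C. wsep s G"
  then obtain s where s: "\<And>G. G \<in> C \<Longrightarrow> wsep s G" by blast
  have "treewidth G \<le> 3 * s + 2" if "G \<in> C" for G
    using assms[OF that] s[OF that] by (rule wsep_imp_treewidth)
  then show "bounded_param treewidth C" unfolding bounded_param_def by blast
qed

text \<open>The weight is pushed forward along \<open>f\<close> and set to 0 off the image, so the
  totals agree. The preimage of a separator works because walks of \<open>H\<close> avoiding it map
  to walks of \<open>G\<close> avoiding the separator.\<close>

lemma wsep_embed:
  assumes sep: "wsep s G" and fin: "finite (gV G)" and inj: "inj_on f (gV H)"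
    and V: "f ` gV H \<subseteq> gV G"
    and E: "\<And>u v. {u, v} \<in> gE H \<Longrightarrow> u \<in> gV H \<Longrightarrow> v \<in> gV H \<Longrightarrow> {f u, f v} \<in> gE G"
  shows "wsep s H"
  unfolding wsep_def
proof
  fix w :: "'b \<Rightarrow> nat"
  define w' where "w' y = (if y \<in> f ` gV H then w (the_inv_into (gV H) f y) else 0)" for y
  have w': "w' (f x) = w x" if "x \<in> gV H" for x
    using that inj by (simp add: w'_def the_inv_into_f_f)
  have finH: "finite (gV H)" using inj V fin by (meson finite_imageD finite_subset)
  have sumw: "sum w' (f ` A) = sum w A" if "A \<subseteq> gV H" for A
    using that w' by (subst sum.reindex) (auto intro: inj_on_subset[OF inj] sum.cong)
  have tot: "sum w' (gV G) = sum w (gV H)"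
    using sumw[of "gV H"] V fin
    by (subst sum.mono_neutral_right[of "gV G" "f ` gV H"]) (auto simp: w'_def)
  from sep obtain S where S: "bal_sep G w' S" "card S \<le> s" unfolding wsep_def by blast
  define S' where "S' = {x \<in> gV H. f x \<in> S}"
  have "finite S" using S(1) fin by (auto simp: bal_sep_def intro: finite_subset)
  then have "card S' \<le> card S"
    by (intro card_inj_on_le[of f]) (auto simp: S'_def intro: inj_on_subset[OF inj])
  moreover have "bal_sep H w S'"
    unfolding bal_sep_def
  proof (intro conjI ballI)
    show "S' \<subseteq> gV H" by (auto simp: S'_def)
    fix x assume x: "x \<in> gV H - S'"
    let ?Y = "{y \<in> gV H. rch H (gV H - S') x y}"
    have "2 * sum w' (f ` ?Y) \<le> sum w' (gV G)"
    proof (rule lightD[OF bal_sepD[OF S(1)] fin])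
      show "f x \<in> gV G - S" using x V by (auto simp: S'_def)
      show "f ` ?Y \<subseteq> gV G" using V by auto
      fix z assume "z \<in> f ` ?Y"
      then obtain y where y: "z = f y" "rch H (gV H - S') x y" by blast
      from y(2) have "rch G (gV G - S) (f x) (f y)"
        by (rule rch_map) (use V E in \<open>auto simp: S'_def\<close>)
      then show "rch G (gV G - S) (f x) z" using y(1) by simp
    qed
    then show "light H w S' x" using sumw[of ?Y] tot by (simp add: light_def)
  qed
  ultimately show "\<exists>S. bal_sep H w S \<and> card S \<le> s" using S(2) by (intro exI[of _ S']) auto
qed

section \<open>Direct products of small treewidth\<close>

lemma gV_direct_prod [simp]: "gV (direct_prod G H) = gV G \<times> gV H"
  by (simp add: direct_prod_def gV_def)

lemma edge_direct_prod [simp]: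
  "{(a, v), (b, u)} \<in> gE (direct_prod G H) \<longleftrightarrow> {a, b} \<in> gE G \<and> {v, u} \<in> gE H"
  by (auto simp: direct_prod_def gE_def doubleton_eq_iff insert_commute)

lemma wf_direct_prod:
  assumes "wf_graph G" and "wf_graph H"
  shows "wf_graph (direct_prod G H)"
  unfolding wf_graph_def
proof (intro conjI ballI)
  show "finite (gV (direct_prod G H))" using assms by (simp add: wf_finite)
  fix e assume "e \<in> gE (direct_prod G H)"
  then obtain a b u v where e: "e = {(a, v), (b, u)}" "{a, b} \<in> gE G" "{u, v} \<in> gE H"
    by (auto simp: direct_prod_def gE_def)
  then show "\<exists>x y. e = {x, y} \<and> x \<noteq> y \<and> x \<in> gV (direct_prod G H) \<and> y \<in> gV (direct_prod G H)"
    using wf_edge[OF assms(1) e(2)] wf_edge[OF assms(2) e(3)]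
    by (intro exI[of _ "(a, v)"] exI[of _ "(b, u)"]) simp
qed

lemma wsep_direct_prod_commute:
  assumes "wsep s (direct_prod G H)" and "finite (gV G)" and "finite (gV H)"
  shows "wsep s (direct_prod H G)"
  by (rule wsep_embed[OF assms(1), where f = prod.swap])
    (use assms(2,3) in \<open>auto simp: inj_on_def\<close>)

section \<open>Components, vertex covers and degrees\<close>

lemma component_edge:
  assumes wf: "wf_graph G" and e: "{u, v} \<in> gE G"
  shows "component G u = component G v"
proof -
  have uv: "rch G (gV G) u v" "u \<in> gV G" "v \<in> gV G"
    using wf_edge[OF wf e] e by (auto intro: rch_step)
  then have "rch G (gV G) u x \<longleftrightarrow> rch G (gV G) v x" for x
    using rch_sym rch_trans by fast
  then show ?thesis using uv by (auto simp: component_def reach_iff_rch[OF wf])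
qed

lemma component_self: "v \<in> gV G \<Longrightarrow> v \<in> component G v"
  by (simp add: component_def reach_def)

lemma component_subset:
  assumes "wf_graph G"
  shows "component G v \<subseteq> gV G"
proof
  fix u assume "u \<in> component G v"
  then have "v \<in> gV G" "rch G (gV G) v u"
    by (simp_all add: component_def reach_iff_rch[OF assms])
  then show "u \<in> gV G" using rch_in by metis
qed

lemma component_closed:
  assumes wf: "wf_graph G" and e: "{u, v} \<in> gE G" and u: "u \<in> component G x"
  shows "v \<in> component G x"
proof -
  have "x \<in> gV G" "rch G (gV G) x u"
    using u by (simp_all add: component_def reach_iff_rch[OF wf])
  moreover have "rch G (gV G) u v" using wf_edge[OF wf e] e by (simp add: rch_step)
  ultimately show ?thesis using rch_trans by (metis component_def mem_Collect_eq reach_iff_rch[OF wf])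
qed

lemma card_component_le:
  assumes "wf_graph G" and "v \<in> gV G"
  shows "card (component G v) \<le> max_comp_size G"
  unfolding max_comp_size_def components_def
  using assms by (intro Max_ge) (auto simp: wf_finite)

lemma max_comp_size_leI:
  assumes "wf_graph G" and "\<And>v. v \<in> gV G \<Longrightarrow> card (component G v) \<le> k"
  shows "max_comp_size G \<le> k"
  unfolding max_comp_size_def components_def
  using assms by (auto simp: wf_finite)

text \<open>Vertex covers of the subgraph induced on \<open>D\<close>, phrased by adjacency in
  \<open>G\<close> so that no induced graph has to be carried through the later arguments.\<close>

definition vcover :: "'a graph \<Rightarrow> 'a set \<Rightarrow> 'a set \<Rightarrow> bool" where
  "vcover G D Q \<longleftrightarrow> Q \<subseteq> D \<and> (\<forall>u\<in>D. \<forall>v\<in>D. {u, v} \<in> gE G \<longrightarrow> u \<in> Q \<or> v \<in> Q)"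

lemma vertex_cover_number_induced:
  assumes wf: "wf_graph G" and D: "D \<subseteq> gV G"
  shows "vertex_cover_number (induced G D) = Min {card Q | Q. vcover G D Q}"
    and "finite {card Q | Q. vcover G D Q}" and "vcover G D D"
proof -
  have "(Q \<subseteq> gV (induced G D) \<and> (\<forall>e\<in>gE (induced G D). e \<inter> Q \<noteq> {})) \<longleftrightarrow> vcover G D Q" for Q
  proof -
    have "gV (induced G D) = D" using D by (auto simp: induced_def gV_def)
    moreover have "(\<forall>e\<in>gE (induced G D). e \<inter> Q \<noteq> {}) \<longleftrightarrow>
      (\<forall>u\<in>D. \<forall>v\<in>D. {u, v} \<in> gE G \<longrightarrow> u \<in> Q \<or> v \<in> Q)"
    proof (intro iffI ballI impI)
      fix u v assume "\<forall>e\<in>gE (induced G D). e \<inter> Q \<noteq> {}" "u \<in> D" "v \<in> D" "{u, v} \<in> gE G"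
      moreover from this have "{u, v} \<in> gE (induced G D)" by (auto simp: induced_def gE_def)
      ultimately have "{u, v} \<inter> Q \<noteq> {}" by blast
      then show "u \<in> Q \<or> v \<in> Q" by blast
    next
      fix e assume *: "\<forall>u\<in>D. \<forall>v\<in>D. {u, v} \<in> gE G \<longrightarrow> u \<in> Q \<or> v \<in> Q" "e \<in> gE (induced G D)"
      then have e: "e \<in> gE G" "e \<subseteq> D" by (auto simp: induced_def gE_def)
      from e(1) wf obtain u v where "e = {u, v}" by (auto simp: wf_graph_def)
      then show "e \<inter> Q \<noteq> {}" using * e by auto
    qed
    ultimately show ?thesis by (simp add: vcover_def)
  qed
  then show "vertex_cover_number (induced G D) = Min {card Q | Q. vcover G D Q}"
    by (simp add: vertex_cover_number_def)
  have "finite D" using D wf_finite[OF wf] by (rule finite_subset)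
  then have "finite (card ` {Q. Q \<subseteq> D})" by simp
  then show "finite {card Q | Q. vcover G D Q}"
    by (rule finite_subset[rotated]) (auto simp: vcover_def)
  show "vcover G D D" by (simp add: vcover_def)
qed

lemma component_vcover:
  assumes wf: "wf_graph G" and v: "v \<in> gV G"
  shows "\<exists>Q. vcover G (component G v) Q \<and> card Q \<le> max_comp_vc G"
proof -
  let ?D = "component G v"
  note vc = vertex_cover_number_induced[OF wf component_subset[OF wf, of v]]
  have "Min {card Q | Q. vcover G ?D Q} \<in> {card Q | Q. vcover G ?D Q}"
    using vc(2,3) by (intro Min_in) auto
  then obtain Q where "vcover G ?D Q" "card Q = vertex_cover_number (induced G ?D)"
    using vc(1) by auto
  moreover have "vertex_cover_number (induced G ?D) \<le> max_comp_vc G"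
    unfolding max_comp_vc_def components_def using wf v by (intro Max_ge) (auto simp: wf_finite)
  ultimately show ?thesis by auto
qed

lemma max_comp_vc_leI:
  assumes wf: "wf_graph G"
    and "\<And>v. v \<in> gV G \<Longrightarrow> \<exists>Q. vcover G (component G v) Q \<and> card Q \<le> k"
  shows "max_comp_vc G \<le> k"
proof -
  have "vertex_cover_number (induced G (component G v)) \<le> k" if v: "v \<in> gV G" for v
  proof -
    note vc = vertex_cover_number_induced[OF wf component_subset[OF wf, of v]]
    obtain Q where Q: "vcover G (component G v) Q" "card Q \<le> k" using assms(2)[OF v] by blast
    have "Min {card Q | Q. vcover G (component G v) Q} \<le> card Q"
      using Q(1) vc(2) by (intro Min_le) auto
    then show ?thesis using Q(2) vc(1) by simp
  qed
  then show ?thesis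
    unfolding max_comp_vc_def components_def using wf by (auto simp: wf_finite)
qed

lemma degree_eq_card_neighbours:
  assumes "wf_graph G"
  shows "degree G v = card {u. {v, u} \<in> gE G}"
proof -
  have "{e \<in> gE G. v \<in> e} = (\<lambda>u. {v, u}) ` {u. {v, u} \<in> gE G}"
  proof
    show "{e \<in> gE G. v \<in> e} \<subseteq> (\<lambda>u. {v, u}) ` {u. {v, u} \<in> gE G}"
    proof
      fix e assume e: "e \<in> {e \<in> gE G. v \<in> e}"
      then obtain a b where ab: "e = {a, b}" using assms by (auto simp: wf_graph_def)
      then have "e = {v, if v = a then b else a}" using e by auto
      then show "e \<in> (\<lambda>u. {v, u}) ` {u. {v, u} \<in> gE G}" using e by blast
    qed
  qed auto
  moreover have "inj_on (\<lambda>u. {v, u}) {u. {v, u} \<in> gE G}"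
    by (auto simp: inj_on_def doubleton_eq_iff)
  ultimately show ?thesis by (simp add: degree_def card_image)
qed

lemma finite_neighbours: "wf_graph G \<Longrightarrow> finite {u. {v, u} \<in> gE G}"
  using wf_edge by (metis (no_types, lifting) finite_subset mem_Collect_eq subsetI wf_finite)

lemma card_neighbours_le:
  assumes "wf_graph G" and "v \<in> gV G"
  shows "card {u. {v, u} \<in> gE G} \<le> max_degree G"
  unfolding max_degree_def degree_eq_card_neighbours[OF assms(1), symmetric]
  using assms by (intro Max_ge) (auto simp: wf_finite)

lemma card_closed_nbhd_le:
  assumes wf: "wf_graph G" and "S \<subseteq> gV G" and "max_degree G \<le> d"
  shows "card (\<Union>z\<in>S. insert z {v. {z, v} \<in> gE G}) \<le> card S * (d + 1)"
proof -
  have fin: "finite S" using assms(2) wf_finite[OF wf] by (rule finite_subset)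
  have "card (\<Union>z\<in>S. insert z {v. {z, v} \<in> gE G}) \<le> (\<Sum>z\<in>S. card (insert z {v. {z, v} \<in> gE G}))"
    by (rule card_UN_le[OF fin])
  also have "\<dots> \<le> (\<Sum>z\<in>S. d + 1)"
  proof (rule sum_mono)
    fix z assume "z \<in> S"
    then have "card {v. {z, v} \<in> gE G} \<le> d"
      using card_neighbours_le[OF wf, of z] assms(2,3) by auto
    then show "card (insert z {v. {z, v} \<in> gE G}) \<le> d + 1"
      using card_insert_le_m1[of "d + 1" "{v. {z, v} \<in> gE G}" z] by simp
  qed
  finally show ?thesis by simp
qed

text \<open>Only the heaviest class of \<open>p\<close> needs a separator, so disjoint unions cost nothing.\<close>

lemma wsep_by_parts:
  assumes fin: "finite (gV G)"
    and p: "\<And>u v. {u, v} \<in> gE G \<Longrightarrow> u \<in> gV G \<Longrightarrow> v \<in> gV G \<Longrightarrow> p u = p v"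
    and part: "\<And>w x0. x0 \<in> gV G \<Longrightarrow>
      \<exists>S \<subseteq> gV G. card S \<le> s \<and> (\<forall>x \<in> gV G - S. p x = p x0 \<longrightarrow> light G w S x)"
  shows "wsep s G"
  unfolding wsep_def
proof
  fix w :: "'a \<Rightarrow> nat"
  let ?V = "gV G"
  have split: "sum w ?V = sum w {y \<in> ?V. p y = c} + sum w {y \<in> ?V. p y \<noteq> c}" for c
    using fin by (subst sum.union_disjoint[symmetric]) (auto intro: sum.cong)
  show "\<exists>S. bal_sep G w S \<and> card S \<le> s"
  proof (cases "\<exists>x0 \<in> ?V. 2 * sum w {y \<in> ?V. p y = p x0} > sum w ?V")
    case True
    then obtain x0 where x0: "x0 \<in> ?V" "2 * sum w {y \<in> ?V. p y = p x0} > sum w ?V" by blast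
    from part[OF x0(1), of w] obtain S where S: "S \<subseteq> ?V" "card S \<le> s"
      and light: "\<And>x. x \<in> gV G - S \<Longrightarrow> p x = p x0 \<Longrightarrow> light G w S x" by blast
    have "light G w S x" if x: "x \<in> ?V - S" for x
    proof (cases "p x = p x0")
      case True
      then show ?thesis by (rule light[OF x])
    next
      case False
      have "2 * sum w {y \<in> ?V. p y \<noteq> p x0} \<le> sum w ?V"
        using split[of "p x0"] x0(2) by linarith
      then show ?thesis
        using x False p by (intro lightI[of _ "{y \<in> ?V. p y \<noteq> p x0}"] fin) auto
    qed
    then show ?thesis using S by (auto simp: bal_sep_def)
  next
    case False
    have "light G w {} x" if x: "x \<in> ?V" for x
    proof -
      have "2 * sum w {y \<in> ?V. p y = p x} \<le> sum w ?V" using False x by force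
      then show ?thesis
        using x p by (intro lightI[of _ "{y \<in> ?V. p y = p x}"] fin) auto
    qed
    then show ?thesis by (intro exI[of _ "{}"]) (simp add: bal_sep_def)
  qed
qed

text \<open>A walk in the product keeps its second coordinate in one component \<open>D\<close> of
  \<open>H\<close>, and while it avoids \<open>S \<times> D\<close> its first coordinate walks in
  \<open>G\<close> minus \<open>S\<close>. Summing the weight over the fibres
  \<open>{u} \<times> D\<close> turns a separator of \<open>G\<close> into one for this part of the
  product.\<close>

lemma wsep_direct_prod_small_components:
  assumes wf: "wf_graph G" "wf_graph H" and sep: "wsep s G" and k: "max_comp_size H \<le> k"
  shows "wsep (s * k) (direct_prod G H)"
proof (rule wsep_by_parts[where p = "component H \<circ> snd"])
  let ?P = "direct_prod G H"
  note fin = wf_finite[OF wf(1)] wf_finite[OF wf(2)]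
  show finP: "finite (gV ?P)" using fin by simp
  show "(component H \<circ> snd) x = (component H \<circ> snd) y" if "{x, y} \<in> gE ?P" for x y
    using that component_edge[OF wf(2)] by (cases x; cases y) auto
  fix w :: "'a \<times> 'b \<Rightarrow> nat" and x0 assume "x0 \<in> gV ?P"
  then obtain u0 v0 where x0: "x0 = (u0, v0)" "v0 \<in> gV H" by auto
  define D where "D = component H v0"
  have DV: "D \<subseteq> gV H" unfolding D_def by (rule component_subset[OF wf(2)])
  define w1 where "w1 u = (\<Sum>v\<in>D. w (u, v))" for u
  have w1: "sum w1 A = sum w (A \<times> D)" for A
    unfolding w1_def by (simp add: sum.cartesian_product)
  from sep obtain S where S: "bal_sep G w1 S" "card S \<le> s" unfolding wsep_def by blast
  have SV: "S \<subseteq> gV G" using S(1) by (simp add: bal_sep_def)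
  have "sum w (gV G \<times> D) \<le> sum w (gV ?P)"
    using fin DV by (intro sum_mono2) auto
  then have tot: "sum w1 (gV G) \<le> sum w (gV ?P)" by (simp only: w1)
  have "card D \<le> k"
    using card_component_le[OF wf(2) x0(2)] k by (simp add: D_def)
  then have card: "card (S \<times> D) \<le> s * k"
    using S(2) by (simp add: card_cartesian_product mult_le_mono)
  have sub: "S \<times> D \<subseteq> gV ?P" using SV DV by auto
  have "light ?P w (S \<times> D) x"
    if x: "x \<in> gV ?P - S \<times> D" "(component H \<circ> snd) x = (component H \<circ> snd) x0" for x
  proof -
    obtain u v where uv: "x = (u, v)" "u \<in> gV G" "v \<in> gV H" using x(1) by auto
    have vD: "v \<in> D"
      using x(2) uv component_self[OF uv(3)] by (simp add: D_def x0(1))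
    then have uS: "u \<in> gV G - S" using x(1) uv by auto
    let ?Y = "{y \<in> gV G. rch G (gV G - S) u y} \<times> D"
    show ?thesis
    proof (rule lightI[OF finP])
      show "?Y \<subseteq> gV ?P" using DV by auto
      show "x \<in> ?Y" using uv vD by simp
      have "2 * sum w1 {y \<in> gV G. rch G (gV G - S) u y} \<le> sum w1 (gV G)"
        using bal_sepD[OF S(1) uS] by (simp add: light_def)
      then show "2 * sum w ?Y \<le> sum w (gV ?P)" using tot w1 by (metis le_trans)
      fix y z assume that: "y \<in> ?Y" "z \<in> gV ?P" "z \<notin> S \<times> D" "{y, z} \<in> gE ?P"
      obtain a b c d where yz: "y = (a, b)" "z = (c, d)" by (cases y; cases z) auto
      have e: "{a, c} \<in> gE G" "{b, d} \<in> gE H" using that(4) yz by auto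
      have dD: "d \<in> D" using component_closed[OF wf(2) e(2)] that(1) yz by (auto simp: D_def)
      then have c: "c \<in> gV G - S" using that(2,3) yz by auto
      have "rch G (gV G - S) u a" using that(1) yz by simp
      moreover from this have "a \<in> gV G - S" using uS by (rule rch_in)
      ultimately have "rch G (gV G - S) u c" using rch_step[OF e(1)] c by (blast intro: rch_trans)
      then show "z \<in> ?Y" using c dD yz by simp
    qed
  qed
  with card sub show "\<exists>S \<subseteq> gV ?P. card S \<le> s * k \<and> (\<forall>x \<in> gV ?P - S.
      (component H \<circ> snd) x = (component H \<circ> snd) x0 \<longrightarrow> light ?P w S x)"
    by (intro exI[of _ "S \<times> D"] conjI ballI impI) assumption+
qed

text \<open>Let \<open>Q\<close> cover a component \<open>D\<close> of \<open>G\<close> and let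
  \<open>N\<close> be the closed neighbourhood of a separator \<open>S\<close> of \<open>H\<close>.
  Of two adjacent vertices over \<open>D\<close>, one has its first coordinate in \<open>Q\<close>.
  If in addition one of them lies over \<open>S\<close>, both lie over \<open>N\<close>, so one is
  in \<open>Q \<times> N\<close>. Hence what remains of \<open>D \<times> S\<close> is isolated, and
  all other walks project into \<open>H\<close> minus \<open>S\<close>.\<close>

lemma wsep_direct_prod_vc_degree:
  assumes wf: "wf_graph G" "wf_graph H" and sep: "wsep s H"
    and c: "max_comp_vc G \<le> c" and d: "max_degree H \<le> d"
  shows "wsep (c * (s * (d + 1)) + 1) (direct_prod G H)"
proof (rule wsep_by_parts[where p = "component G \<circ> fst"])
  let ?P = "direct_prod G H" and ?s = "c * (s * (d + 1)) + 1"
  note fin = wf_finite[OF wf(1)] wf_finite[OF wf(2)]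
  show finP: "finite (gV ?P)" using fin by simp
  show "(component G \<circ> fst) x = (component G \<circ> fst) y" if "{x, y} \<in> gE ?P" for x y
    using that component_edge[OF wf(1)] by (cases x; cases y) auto
  fix w :: "'a \<times> 'b \<Rightarrow> nat" and x0 assume "x0 \<in> gV ?P"
  then obtain u0 v0 where x0: "x0 = (u0, v0)" "u0 \<in> gV G" by auto
  define D where "D = component G u0"
  have DV: "D \<subseteq> gV G" unfolding D_def by (rule component_subset[OF wf(1)])
  show "\<exists>S \<subseteq> gV ?P. card S \<le> ?s \<and> (\<forall>x \<in> gV ?P - S.
      (component G \<circ> fst) x = (component G \<circ> fst) x0 \<longrightarrow> light ?P w S x)"
  \<comment> \<open>An isolated vertex is light unless it alone carries more than half of the
    weight. In that case this single vertex is the separator, which accounts for the summand 1 in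
    the bound.\<close>
  proof (cases "\<exists>y \<in> gV ?P. 2 * w y > sum w (gV ?P)")
    case True
    then obtain y where y: "y \<in> gV ?P" "2 * w y > sum w (gV ?P)" by blast
    have "sum w (gV ?P) = w y + sum w (gV ?P - {y})" using finP y(1) by (rule sum.remove)
    then have "2 * sum w (gV ?P - {y}) \<le> sum w (gV ?P)" using y(2) by linarith
    then have "light ?P w {y} x" if "x \<in> gV ?P - {y}" for x
      using that by (intro lightI[OF finP, of "gV ?P - {y}"]) auto
    then show ?thesis using y(1) by (intro exI[of _ "{y}"]) auto
  next
    case no_heavy: False
    obtain Q where Q: "vcover G D Q" "card Q \<le> c"
      using component_vcover[OF wf(1) x0(2)] c by (auto simp: D_def)
    have QD: "Q \<subseteq> D" using Q(1) by (simp add: vcover_def)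
    define w2 where "w2 v = (\<Sum>u\<in>D. w (u, v))" for v
    have w2: "sum w2 A = sum w (D \<times> A)" for A
      unfolding w2_def by (subst sum.swap) (simp add: sum.cartesian_product)
    from sep obtain S where S: "bal_sep H w2 S" "card S \<le> s" unfolding wsep_def by blast
    have SV: "S \<subseteq> gV H" using S(1) by (simp add: bal_sep_def)
    have "sum w (D \<times> gV H) \<le> sum w (gV ?P)"
      using fin DV by (intro sum_mono2) auto
    then have tot: "sum w2 (gV H) \<le> sum w (gV ?P)" by (simp only: w2)
    define N where "N = (\<Union>z\<in>S. insert z {v. {z, v} \<in> gE H})"
    have SN: "S \<subseteq> N" by (auto simp: N_def)
    have N_nb: "v \<in> N" if "z \<in> S" "{v, z} \<in> gE H" for z v
    proof -
      have "{z, v} \<in> gE H" using that(2) by (simp add: insert_commute)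
      then show ?thesis using that(1) by (auto simp: N_def)
    qed
    have NV: "N \<subseteq> gV H" using SV wf_edge(2)[OF wf(2)] unfolding N_def by blast
    have "card N \<le> s * (d + 1)"
      using card_closed_nbhd_le[OF wf(2) SV d] S(2) unfolding N_def
      by (meson le_trans mult_le_mono1)
    then have card: "card (Q \<times> N) \<le> ?s"
      using mult_le_mono[OF Q(2)] by (simp add: card_cartesian_product le_SucI)
    have sub: "Q \<times> N \<subseteq> gV ?P" using QD DV NV by auto
    have cover: "a \<in> Q \<or> b \<in> Q" if "{a, b} \<in> gE G" "a \<in> D" "b \<in> D" for a b
      using Q(1) that by (auto simp: vcover_def)
    have D_nb: "b \<in> D" if "{a, b} \<in> gE G" "a \<in> D" for a b
      using component_closed[OF wf(1) that(1)] that(2) by (simp add: D_def)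
    have "light ?P w (Q \<times> N) x"
      if x: "x \<in> gV ?P - Q \<times> N" "(component G \<circ> fst) x = (component G \<circ> fst) x0" for x
    proof -
      obtain u v where uv: "x = (u, v)" "u \<in> gV G" "v \<in> gV H" using x(1) by auto
      have uD: "u \<in> D"
        using x(2) uv component_self[OF uv(2)] by (simp add: D_def x0(1))
      show ?thesis
      proof (cases "v \<in> S")
        case True
        \<comment> \<open>Here \<open>u \<notin> Q\<close>, so all neighbours of \<open>x\<close> lie in the separator and \<open>x\<close> is isolated.\<close>
        then have uQ: "u \<notin> Q" using x(1) uv SN by auto
        show ?thesis
        proof (rule lightI[OF finP, of "{x}"])
          show "{x} \<subseteq> gV ?P" using x(1) by simp
          show "2 * sum w {x} \<le> sum w (gV ?P)" using no_heavy uv by (simp add: not_less)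
          fix y z assume *: "y \<in> {x}" "z \<notin> Q \<times> N" "{y, z} \<in> gE ?P"
          obtain a b where z: "z = (a, b)" by (cases z)
          have e: "{u, a} \<in> gE G" "{v, b} \<in> gE H" using * uv z by auto
          have "a \<in> Q" using cover[OF e(1) uD D_nb[OF e(1) uD]] uQ by simp
          moreover have "b \<in> N" using N_nb[OF True, of b] e(2) by (simp add: insert_commute)
          ultimately show "z \<in> {x}" using *(2) z by simp
        qed simp
      next
        case False
        then have vS: "v \<in> gV H - S" using uv by simp
        let ?Y = "D \<times> {y \<in> gV H. rch H (gV H - S) v y}"
        show ?thesis
        proof (rule lightI[OF finP])
          show "?Y \<subseteq> gV ?P" using DV by auto
          show "x \<in> ?Y" using uv uD by simp
          have "2 * sum w2 {y \<in> gV H. rch H (gV H - S) v y} \<le> sum w2 (gV H)"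
            using bal_sepD[OF S(1) vS] by (simp add: light_def)
          then show "2 * sum w ?Y \<le> sum w (gV ?P)" using tot w2 by (metis le_trans)
          fix y z assume that: "y \<in> ?Y" "z \<in> gV ?P" "y \<notin> Q \<times> N" "z \<notin> Q \<times> N" "{y, z} \<in> gE ?P"
          obtain a b c d where yz: "y = (a, b)" "z = (c, d)" by (cases y; cases z) auto
          have e: "{a, c} \<in> gE G" "{b, d} \<in> gE H" using that(5) yz by auto
          have aD: "a \<in> D" using that(1) yz by simp
          have cD: "c \<in> D" using D_nb[OF e(1) aD] .
          \<comment> \<open>No surviving edge enters the fibre over \<open>S\<close>: the endpoint
            with first coordinate in \<open>Q\<close> would lie in
            \<open>Q \<times> N\<close>.\<close>
          have "d \<notin> S"
          proof
            assume dS: "d \<in> S"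
            then have "c \<notin> Q" using that(4) yz SN by auto
            moreover have "a \<notin> Q" using N_nb[OF dS e(2)] that(3) yz by simp
            ultimately show False using cover[OF e(1) aD cD] by simp
          qed
          then have d: "d \<in> gV H - S" using that(2) yz by simp
          have "rch H (gV H - S) v b" using that(1) yz by simp
          moreover from this have "b \<in> gV H - S" using vS by (rule rch_in)
          ultimately have "rch H (gV H - S) v d" using rch_step[OF e(2)] d by (blast intro: rch_trans)
          then show "z \<in> ?Y" using d cD yz by simp
        qed
      qed
    qed
    with card sub show ?thesis
      by (intro exI[of _ "Q \<times> N"] conjI ballI impI) assumption+
  qed
qed

section \<open>The bipartite double cover\<close>

lemma gV_K2 [simp]: "gV K2 = {0, 1}"
  by (simp add: K2_def gV_def)

lemma K2_simps:
  "{i, j} \<in> gE K2 \<longleftrightarrow> i \<in> {0, 1} \<and> j = 1 - i"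
  "wf_graph K2"
  by (auto simp: K2_def gV_def gE_def wf_graph_def doubleton_eq_iff)

text \<open>Every edge of a walk switches the sheet, so \<open>j\<close> depends only on
  \<open>i\<close> and the parity of the walk. Both lifts are stated together because they must
  share this parity.\<close>

lemma rch_lift_K2:
  assumes "rch G A u v" and "i \<in> {0, 1}"
  shows "\<exists>j\<in>{0, 1}. rch (direct_prod G K2) (A \<times> {0, 1}) (u, i) (v, j) \<and>
    rch (direct_prod G K2) (A \<times> {0, 1}) (u, 1 - i) (v, 1 - j)"
  using assms(1)
proof (induction rule: rch_induct)
  case base
  show ?case using assms(2) by (intro bexI[of _ i]) simp_all
next
  case (step a b)
  let ?r = "rch (direct_prod G K2) (A \<times> {0, 1})"
  from step(1) obtain j where j: "j \<in> {0, 1}" "?r (u, i) (a, j)" "?r (u, 1 - i) (a, 1 - j)" by blast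
  have up: "?r (a, k) (b, 1 - k)" if "k \<in> {0, 1}" for k
    using step(3-5) that by (intro rch_step) (auto simp: K2_simps)
  have k: "1 - j \<in> {0, 1}" using j(1) by auto
  show ?case
    using rch_trans[OF j(2) up[OF j(1)]] rch_trans[OF j(3) up[OF k]] k by (intro bexI conjI)
qed

text \<open>The factor 2 counts two uses of the hypothesis, for the pulled-back weights and for the
  weights on the lifted component; the separator of \<open>G\<close> is the union of the two
  projections.\<close>

lemma wsep_double_cover:
  assumes wf: "wf_graph G" and sep: "wsep s (direct_prod G K2)"
  shows "wsep (2 * s) G"
  unfolding wsep_def
proof
  fix w :: "'a \<Rightarrow> nat"
  let ?P = "direct_prod G K2" and ?V = "gV G"
  have fin: "finite ?V" by (rule wf_finite[OF wf])
  have PV: "gV ?P = ?V \<times> {0, 1}" by simp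
  have finP: "finite (gV ?P)" using fin by simp
  have card_fst: "card (fst ` S) \<le> s" if "card S \<le> s" "S \<subseteq> gV ?P" for S
    using card_image_le[of S fst] that finP by (meson finite_subset le_trans)
  define w' where "w' = (\<lambda>(v :: 'a, i :: nat). w v)"
  have w': "sum w' (A \<times> {0, 1}) = 2 * sum w A" for A
    unfolding w'_def by (simp add: sum.cartesian_product[symmetric] sum_distrib_left mult_2)
  from sep obtain S where S: "bal_sep ?P w' S" "card S \<le> s" unfolding wsep_def by blast
  have SV: "S \<subseteq> gV ?P" using S(1) by (simp add: bal_sep_def)
  define S' where "S' = fst ` S"
  define A where "A = ?V - S'"
  have S'V: "S' \<subseteq> ?V" using SV by (auto simp: S'_def PV)
  have AS: "A \<times> {0, 1} \<subseteq> gV ?P - S" by (force simp: A_def S'_def PV)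
  have cS': "card S' \<le> s" unfolding S'_def using card_fst S(2) SV by blast
  show "\<exists>S. bal_sep G w S \<and> card S \<le> 2 * s"
  proof (cases "\<forall>x\<in>?V - S'. light G w S' x")
    case True
    then show ?thesis using S'V cS' by (intro exI[of _ S']) (auto simp: bal_sep_def)
  next
    case False
    then obtain x where x: "x \<in> A" "\<not> light G w S' x" by (auto simp: A_def)
    define X where "X = {y \<in> ?V. rch G A x y}"
    have heavy: "2 * sum w X > sum w ?V" using x(2) by (simp add: light_def X_def A_def)
    have XV: "X \<subseteq> ?V" by (auto simp: X_def)
    have XA: "y \<in> A" if "y \<in> X" for y using that x(1) rch_in[of G A x y] by (simp add: X_def)
    have X_rch: "rch G A y z" if "y \<in> X" "z \<in> X" for y z
      using that rch_trans[OF rch_sym[of G A x y], of z] by (simp add: X_def)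
    have X_nb: "v \<in> X" if "u \<in> X" "{u, v} \<in> gE G" "v \<in> A" for u v
      using rch_trans[OF _ rch_step[OF that(2) XA[OF that(1)] that(3)], of x] that
      by (simp add: X_def A_def)
    let ?r = "rch ?P (A \<times> {0, 1})"
    \<comment> \<open>If the two copies of one \<open>y\<close> were joined, parity could be
      corrected at will and all of \<open>X \<times> {0, 1}\<close> would lie in one component
      outside \<open>S\<close>. It carries more than half of the pulled-back weight, against the
      choice of \<open>S\<close>.\<close>
    have bip: "\<not> ?r (y, 0) (y, 1)" if y: "y \<in> X" for y
    proof
      assume yy: "?r (y, 0) (y, 1)"
      have all: "?r (y, 0) p" if p: "p \<in> X \<times> {0, 1}" for p
      proof -
        obtain z k where zk: "p = (z, k)" "z \<in> X" "k \<in> {0, 1}" using p by auto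
        have "(0 :: nat) \<in> {0, 1}" by simp
        from rch_lift_K2[OF X_rch[OF y zk(2)] this] obtain j where
          j: "j \<in> {0, 1}" "?r (y, 0) (z, j)" "?r (y, 1 - 0) (z, 1 - j)" by blast
        have "?r (y, 0) (z, 1 - j)" using rch_trans[OF yy, of "(z, 1 - j)"] j(3) by simp
        moreover have "k = j \<or> k = 1 - j" using zk(3) j(1) by auto
        ultimately show ?thesis using zk(1) j(2) by metis
      qed
      have "2 * sum w' (X \<times> {0, 1}) \<le> sum w' (gV ?P)"
      proof (rule lightD[OF bal_sepD[OF S(1)] finP])
        show "(y, 0) \<in> gV ?P - S" using AS XA[OF y] by auto
        show "X \<times> {0, 1} \<subseteq> gV ?P" using XV by (auto simp: PV)
        show "rch ?P (gV ?P - S) (y, 0) p" if "p \<in> X \<times> {0, 1}" for p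
          using all[OF that] AS by (rule rch_mono)
      qed
      then show False using heavy by (simp only: PV w')
    qed
    \<comment> \<open>\<open>c y\<close> is the sheet over \<open>y\<close> reached from
      \<open>(x, 0)\<close>, unique on \<open>X\<close> by \<open>bip\<close>. It is a proper
      2-colouring of \<open>X\<close>, and its graph is the lifted copy.\<close>
    define c :: "'a \<Rightarrow> nat" where "c y = (if ?r (x, 0) (y, 0) then 0 else 1)" for y
    have c01: "c y \<in> {0, 1}" for y by (simp add: c_def)
    have c: "?r (x, 0) (y, c y)" if "y \<in> X" for y
    proof -
      have "rch G A x y" "(0 :: nat) \<in> {0, 1}" using that by (simp_all add: X_def)
      from rch_lift_K2[OF this] obtain j where "j \<in> {0, 1}" "?r (x, 0) (y, j)" by blast
      then show ?thesis unfolding c_def by auto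
    qed
    have colour: "{c u, c v} \<in> gE K2" if uv: "{u, v} \<in> gE G" "u \<in> X" "v \<in> X" for u v
    proof (rule ccontr)
      assume "{c u, c v} \<notin> gE K2"
      then have eq: "c v = c u" using c01[of u] c01[of v] by (auto simp: K2_simps)
      have "?r (u, c u) (v, 1 - c u)"
        using uv XA c01[of u] by (intro rch_step) (auto simp: K2_simps)
      from rch_trans[OF c[OF uv(2)] this] have "?r (x, 0) (v, 1 - c v)" by (simp only: eq)
      from rch_trans[OF rch_sym[OF c[OF uv(3)]] this] have "?r (v, c v) (v, 1 - c v)" .
      then have "?r (v, 0) (v, 1)"
        using c01[of v] rch_sym[of ?P "A \<times> {0, 1}" "(v, 1)" "(v, 0)"] by auto
      then show False using bip[OF uv(3)] by simp
    qed
    \<comment> \<open>All weight sits on the lifted copy, so the total is \<open>sum w X\<close>,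
      and half of it is at most half of the weight of \<open>G\<close>.\<close>
    define w2 where "w2 = (\<lambda>(v, i). if v \<in> X \<and> i = c v then w v else 0)"
    have tot: "sum w2 (gV ?P) = sum w X"
    proof -
      have "sum w2 (gV ?P) = (\<Sum>v\<in>?V. \<Sum>i\<in>{0, 1}. w2 (v, i))"
        unfolding PV by (simp only: sum.cartesian_product) (simp add: case_prod_unfold)
      also have "\<dots> = (\<Sum>v\<in>?V. if v \<in> X then w v else 0)"
      proof (rule sum.cong)
        show "(\<Sum>i\<in>{0, 1}. w2 (v, i)) = (if v \<in> X then w v else 0)" for v
          using c01[of v] by (auto simp: w2_def)
      qed simp
      also have "\<dots> = sum w X" using fin XV by (simp add: sum.If_cases inf_absorb2)
      finally show ?thesis .
    qed
    from sep obtain S2 where S2: "bal_sep ?P w2 S2" "card S2 \<le> s" unfolding wsep_def by blast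
    have S2V: "S2 \<subseteq> gV ?P" using S2(1) by (simp add: bal_sep_def)
    define T where "T = S' \<union> fst ` S2"
    have TV: "T \<subseteq> ?V" using S'V S2V by (auto simp: T_def PV)
    have "card T \<le> card S' + card (fst ` S2)" unfolding T_def by (rule card_Un_le)
    then have cT: "card T \<le> 2 * s" using cS' card_fst[OF S2(2) S2V] by linarith
    have "light G w T z" if z: "z \<in> ?V - T" for z
    proof (cases "z \<in> X")
      case False
      show ?thesis
      proof (rule lightI[OF fin, of "?V - X"])
        show "z \<in> ?V - X" using z False by simp
        have "sum w ?V = sum w (?V - X) + sum w X" using XV fin by (rule sum.subset_diff)
        then show "2 * sum w (?V - X) \<le> sum w ?V" using heavy by linarith
        fix u v assume *: "u \<in> ?V - X" "v \<in> ?V" "u \<notin> T" "{u, v} \<in> gE G"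
        then have "v \<notin> X" using X_nb[of v u] by (auto simp: insert_commute A_def T_def)
        then show "v \<in> ?V - X" using * by simp
      qed simp
    next
      case zX: True
      let ?Y = "{y \<in> ?V. rch G (?V - T) z y}"
      \<comment> \<open>Since \<open>T\<close> contains \<open>S'\<close>, a walk avoiding
        \<open>T\<close> cannot leave \<open>X\<close>; it therefore lifts along
        \<open>c\<close>.\<close>
      have in_X: "y \<in> X \<and> rch G (X - T) z y" if "rch G (?V - T) z y" for y
        using that
      proof (induction rule: rch_induct)
        case base
        then show ?case using zX by simp
      next
        case (step u v)
        then have "v \<in> X" using X_nb[of u v] by (auto simp: A_def T_def)
        moreover have "rch G (X - T) u v"
          using step \<open>v \<in> X\<close> by (intro rch_step) auto
        ultimately show ?case using rch_trans[of G "X - T" z u v] step(1) by blast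
      qed
      let ?g = "\<lambda>y. (y, c y)"
      have "2 * sum w2 (?g ` ?Y) \<le> sum w2 (gV ?P)"
      proof (rule lightD[OF bal_sepD[OF S2(1)] finP])
        have T_out: "?g u \<in> gV ?P - S2" if "u \<in> X - T" for u
          using that XV c01[of u] by (force simp: PV T_def)
        show "?g z \<in> gV ?P - S2" using T_out zX z by simp
        show "?g ` ?Y \<subseteq> gV ?P" unfolding PV using c01 by blast
        fix p assume "p \<in> ?g ` ?Y"
        then obtain y where y: "p = ?g y" "rch G (?V - T) z y" by blast
        have "rch ?P (gV ?P - S2) (?g z) (?g y)"
          by (rule rch_map[OF conjunct2[OF in_X[OF y(2)]]])
            (use T_out colour in \<open>auto simp del: gV_direct_prod\<close>)
        then show "rch ?P (gV ?P - S2) (?g z) p" using y(1) by simp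
      qed
      moreover have "sum w2 (?g ` ?Y) = sum w ?Y"
        using in_X by (subst sum.reindex) (auto simp: inj_on_def w2_def intro!: sum.cong)
      moreover have "sum w X \<le> sum w ?V" using XV fin by (intro sum_mono2) auto
      ultimately show ?thesis using tot by (simp add: light_def)
    qed
    then show ?thesis using TV cT by (intro exI[of _ T]) (auto simp: bal_sep_def)
  qed
qed

section \<open>Direct products of large treewidth\<close>

lemma card_hit_le:
  assumes "finite S" and "\<And>i j. i \<in> I \<Longrightarrow> j \<in> I \<Longrightarrow> i \<noteq> j \<Longrightarrow> R i \<inter> R j = {}"
  shows "card {i \<in> I. R i \<inter> S \<noteq> {}} \<le> card S"
proof -
  define h where "h i = (SOME x. x \<in> R i \<inter> S)" for i
  have h: "h i \<in> R i \<inter> S" if "R i \<inter> S \<noteq> {}" for i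
    unfolding h_def using that some_in_eq by blast
  have "inj_on h {i \<in> I. R i \<inter> S \<noteq> {}}"
  proof (rule inj_onI)
    fix i j assume ij: "i \<in> {i \<in> I. R i \<inter> S \<noteq> {}}" "j \<in> {i \<in> I. R i \<inter> S \<noteq> {}}" "h i = h j"
    then have "h i \<in> R i \<inter> R j" using h[of i] h[of j] by auto
    then show "i = j" using assms(2)[of i j] ij by blast
  qed
  moreover have "h ` {i \<in> I. R i \<inter> S \<noteq> {}} \<subseteq> S" using h by blast
  ultimately show ?thesis using assms(1) by (rule card_inj_on_le)
qed

text \<open>A set of \<open>s\<close> vertices leaves one of \<open>s + 1\<close> disjoint columns
  and at least \<open>s + 1\<close> of \<open>2 * s + 1\<close> disjoint rows untouched. These rows
  are joined through the free column, so one component contains more than half of the marked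
  vertices \<open>x i\<close>. Rows and columns may overlap each other, and only the walks from
  \<open>x i\<close> to \<open>y j\<close> matter.\<close>

lemma not_wsep_rows_columns:
  assumes fin: "finite (gV G)" and cI: "card I = 2 * s + 1" and cJ: "card J = s + 1"
    and R: "\<And>i. i \<in> I \<Longrightarrow> R i \<subseteq> gV G" and C: "\<And>j. j \<in> J \<Longrightarrow> C j \<subseteq> gV G"
    and R_disj: "\<And>i i'. i \<in> I \<Longrightarrow> i' \<in> I \<Longrightarrow> i \<noteq> i' \<Longrightarrow> R i \<inter> R i' = {}"
    and C_disj: "\<And>j j'. j \<in> J \<Longrightarrow> j' \<in> J \<Longrightarrow> j \<noteq> j' \<Longrightarrow> C j \<inter> C j' = {}"
    and x: "\<And>i. i \<in> I \<Longrightarrow> x i \<in> R i"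
    and con: "\<And>i j. i \<in> I \<Longrightarrow> j \<in> J \<Longrightarrow> rch G (R i \<union> C j) (x i) (y j)"
  shows "\<not> wsep s G"
proof
  assume "wsep s G"
  define w where "w v = (if v \<in> x ` I then 1 else 0 :: nat)" for v
  from \<open>wsep s G\<close> obtain S where S: "bal_sep G w S" "card S \<le> s" unfolding wsep_def by blast
  have SV: "S \<subseteq> gV G" using S(1) by (simp add: bal_sep_def)
  then have finS: "finite S" using fin by (rule finite_subset)
  have finI: "finite I" "finite J" using cI cJ card.infinite by force+
  have "card {j \<in> J. C j \<inter> S \<noteq> {}} \<le> s"
    using card_hit_le[OF finS, of J C] C_disj S(2) by fastforce
  then have "{j \<in> J. C j \<inter> S \<noteq> {}} \<noteq> J" using cJ by auto
  then obtain j where j: "j \<in> J" "C j \<inter> S = {}" by blast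
  define I' where "I' = {i \<in> I. R i \<inter> S = {}}"
  have "card {i \<in> I. R i \<inter> S \<noteq> {}} \<le> s"
    using card_hit_le[OF finS, of I R] R_disj S(2) by fastforce
  moreover have "card I = card I' + card {i \<in> I. R i \<inter> S \<noteq> {}}"
    unfolding I'_def using finI by (subst card_Un_disjoint[symmetric]) (auto intro: arg_cong[of _ _ card])
  ultimately have big: "card I' \<ge> s + 1" using cI by linarith
  then have "I' \<noteq> {}" by auto
  then obtain i0 where i0: "i0 \<in> I'" by blast
  have inj: "inj_on x I"
  proof (rule inj_onI)
    fix i i' assume "i \<in> I" "i' \<in> I" "x i = x i'"
    then show "i = i'" using x[of i] x[of i'] R_disj[of i i'] by auto
  qed
  have to_y: "rch G (gV G - S) (x i) (y j)" if "i \<in> I'" for i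
  proof -
    have "rch G (R i \<union> C j) (x i) (y j)" using con that j(1) by (simp add: I'_def)
    moreover have "R i \<union> C j \<subseteq> gV G - S" using R[of i] C[of j] that j by (auto simp: I'_def)
    ultimately show ?thesis by (rule rch_mono)
  qed
  have xV: "x i \<in> gV G" if "i \<in> I" for i using x[OF that] R[OF that] by blast
  have "2 * sum w (x ` I') \<le> sum w (gV G)"
  proof (rule lightD[OF bal_sepD[OF S(1)] fin])
    show "x i0 \<in> gV G - S" using i0 xV x[of i0] by (auto simp: I'_def)
    show "x ` I' \<subseteq> gV G" using xV by (auto simp: I'_def)
    show "rch G (gV G - S) (x i0) v" if v: "v \<in> x ` I'" for v
    proof -
      obtain i where "i \<in> I'" "v = x i" using v by blast
      then show ?thesis using rch_trans[OF to_y[OF i0] rch_sym[OF to_y[of i]]] by simp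
    qed
  qed
  moreover have "sum w (x ` I') = card I'"
  proof -
    have "sum w (x ` I') = card (x ` I' \<inter> x ` I)"
      unfolding w_def using finI by (intro sum_indicator_card) (auto simp: I'_def)
    moreover have "x ` I' \<inter> x ` I = x ` I'" by (auto simp: I'_def)
    moreover have "card (x ` I') = card I'"
      by (rule card_image) (rule inj_on_subset[OF inj], auto simp: I'_def)
    ultimately show ?thesis by simp
  qed
  moreover have "sum w (gV G) = card I"
  proof -
    have "sum w (gV G) = card (gV G \<inter> x ` I)"
      unfolding w_def using fin by (rule sum_indicator_card)
    moreover have "gV G \<inter> x ` I = x ` I" using xV by auto
    ultimately show ?thesis using card_image[OF inj] by simp
  qed
  ultimately show False using big cI by linarith
qed

section \<open>Products of paths, spiders and stars\<close>

definition path_in :: "'a graph \<Rightarrow> nat \<Rightarrow> (nat \<Rightarrow> 'a) \<Rightarrow> bool" where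
  "path_in G m f \<longleftrightarrow> inj_on f {..<m} \<and> f ` {..<m} \<subseteq> gV G \<and>
     (\<forall>i. Suc i < m \<longrightarrow> {f i, f (Suc i)} \<in> gE G)"

text \<open>The legs are \<open>c\<close>, \<open>a\<close>, \<open>h a\<close>. A foot may coincide
  with \<open>c\<close>, by injectivity for at most one \<open>a\<close>; this does no harm, since a
  row may meet a column.\<close>

definition spider :: "'a graph \<Rightarrow> nat \<Rightarrow> 'a \<Rightarrow> 'a set \<Rightarrow> ('a \<Rightarrow> 'a) \<Rightarrow> bool" where
  "spider G n c A h \<longleftrightarrow> finite A \<and> card A = n \<and> inj_on h A \<and> h ` A \<inter> A = {} \<and>
     (\<forall>a\<in>A. {c, a} \<in> gE G \<and> {a, h a} \<in> gE G)"

text \<open>A product edge changes both coordinates, so walking along the path makes the other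
  coordinate alternate between \<open>p\<close> and \<open>q\<close>. Only even displacements return
  to \<open>p\<close>, whence the step of two.\<close>

lemma zigzag:
  assumes f: "path_in G m f" and e: "{p, q} \<in> gE H" and "k + 2 * j < m"
  shows "rch (direct_prod G H) (f ` {..<m} \<times> {p, q}) (f k, p) (f (k + 2 * j), p)"
  using assms(3)
proof (induction j)
  case (Suc j)
  let ?X = "f ` {..<m} \<times> {p, q}" and ?i = "k + 2 * j"
  have edge: "{f i, f (Suc i)} \<in> gE G" if "Suc i < m" for i
    using f that by (simp add: path_in_def)
  have "{(f ?i, p), (f (Suc ?i), q)} \<in> gE (direct_prod G H)"
    using e edge[of ?i] Suc.prems by simp
  then have 1: "rch (direct_prod G H) ?X (f ?i, p) (f (Suc ?i), q)"
    by (rule rch_step) (use Suc.prems in auto)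
  have "{(f (Suc ?i), q), (f (Suc (Suc ?i)), p)} \<in> gE (direct_prod G H)"
    using e edge[of "Suc ?i"] Suc.prems by (simp add: insert_commute)
  then have 2: "rch (direct_prod G H) ?X (f (Suc ?i), q) (f (Suc (Suc ?i)), p)"
    by (rule rch_step) (use Suc.prems in auto)
  have "rch (direct_prod G H) ?X (f k, p) (f ?i, p)" using Suc by simp
  from rch_trans[OF rch_trans[OF this 1] 2] show ?case by simp
qed simp

lemma zigzag':
  assumes f: "path_in G m f" and e: "{p, q} \<in> gE H" and "k + 2 * j < m"
  shows "rch (direct_prod H G) ({p, q} \<times> f ` {..<m}) (p, f k) (p, f (k + 2 * j))"
proof -
  have "rch (direct_prod H G) ({p, q} \<times> f ` {..<m}) (prod.swap (f k, p)) (prod.swap (f (k + 2 * j), p))"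
    by (rule rch_map[OF zigzag[OF assms]]) auto
  then show ?thesis by simp
qed

lemma path_in_eq:
  assumes "path_in G m f" and "i < m" and "j < m" and "f i = f j"
  shows "i = j"
  using assms by (auto simp: path_in_def dest: inj_onD)

lemma path_in_V: "path_in G m f \<Longrightarrow> i < m \<Longrightarrow> f i \<in> gV G"
  by (auto simp: path_in_def)

text \<open>Rows and columns are strips, a whole path times one edge of the other path;
  \<open>4 * s + 2\<close> vertices provide \<open>2 * s + 1\<close> disjoint edges. Row
  \<open>i\<close> and column \<open>j\<close> are joined at \<open>(f (2 * j), g (2 * i))\<close>,
  which both zigzags reach because all indices are even.\<close>

lemma not_wsep_path_path:
  assumes wf: "wf_graph G" "wf_graph H"
    and f: "path_in G (4 * s + 2) f" and g: "path_in H (4 * s + 2) g"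
  shows "\<not> wsep s (direct_prod G H)"
proof (rule not_wsep_rows_columns[where I = "{..<2 * s + 1}" and J = "{..<s + 1}"])
  let ?m = "4 * s + 2"
  let ?R = "\<lambda>i. f ` {..<?m} \<times> {g (2 * i), g (Suc (2 * i))}"
  let ?C = "\<lambda>j. {f (2 * j), f (Suc (2 * j))} \<times> g ` {..<?m}"
  show "finite (gV (direct_prod G H))" using wf_finite[OF wf(1)] wf_finite[OF wf(2)] by simp
  show "?R i \<subseteq> gV (direct_prod G H)" if "i \<in> {..<2 * s + 1}" for i
    using that path_in_V[OF f] path_in_V[OF g] by auto
  show "?C j \<subseteq> gV (direct_prod G H)" if "j \<in> {..<s + 1}" for j
    using that path_in_V[OF f] path_in_V[OF g] by auto
  have sep: "{h (2 * i), h (Suc (2 * i))} \<inter> {h (2 * j), h (Suc (2 * j))} = {}"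
    if "path_in K ?m h" "i < 2 * s + 1" "j < 2 * s + 1" "i \<noteq> j" for h :: "nat \<Rightarrow> 'c" and K i j
  proof -
    have ne: "h a \<noteq> h b" if "a < ?m" "b < ?m" "a \<noteq> b" for a b
      using path_in_eq[OF \<open>path_in K ?m h\<close> that(1,2)] that(3) by blast
    have "h (2 * i) \<noteq> h (2 * j)" "h (2 * i) \<noteq> h (Suc (2 * j))"
      "h (Suc (2 * i)) \<noteq> h (2 * j)" "h (Suc (2 * i)) \<noteq> h (Suc (2 * j))"
      using that(2-4) by (intro ne; presburger)+
    then show ?thesis by auto
  qed
  show "?R i \<inter> ?R j = {}" if "i \<in> {..<2 * s + 1}" "j \<in> {..<2 * s + 1}" "i \<noteq> j" for i j
    using sep[OF g, of i j] that by blast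
  show "?C i \<inter> ?C j = {}" if "i \<in> {..<s + 1}" "j \<in> {..<s + 1}" "i \<noteq> j" for i j
    using sep[OF f, of i j] that by (simp add: Times_Int_Times)
  show "(f 0, g (2 * i)) \<in> ?R i" for i by simp
  show "rch (direct_prod G H) (?R i \<union> ?C j) (f 0, g (2 * i)) (f (2 * j), g 0)"
    if ij: "i \<in> {..<2 * s + 1}" "j \<in> {..<s + 1}" for i j
  proof -
    have "{g (2 * i), g (Suc (2 * i))} \<in> gE H" "{f (2 * j), f (Suc (2 * j))} \<in> gE G"
      using f g ij by (auto simp: path_in_def)
    then have 1: "rch (direct_prod G H) (?R i) (f 0, g (2 * i)) (f (2 * j), g (2 * i))"
      and 2: "rch (direct_prod G H) (?C j) (f (2 * j), g 0) (f (2 * j), g (2 * i))"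
      using zigzag[OF f, of "g (2 * i)" "g (Suc (2 * i))" H 0 j]
        zigzag'[OF g, of "f (2 * j)" "f (Suc (2 * j))" G 0 i] ij by auto
    show ?thesis
      by (rule rch_trans[OF rch_mono[OF 1 Un_upper1] rch_mono[OF rch_sym[OF 2] Un_upper2]])
  qed
qed simp_all

text \<open>The outer edge \<open>{a, h a}\<close> of a leg makes room for a zigzag, which is why
  legs have length two. Columns are single vertices over the centre. A row starts at index 1 so that
  it meets \<open>a\<close> at odd indices, next to the column vertex at the even index
  before.\<close>

lemma not_wsep_spider_path:
  assumes wf: "wf_graph G" "wf_graph H"
    and A: "spider G (2 * s + 1) c A h" and g: "path_in H (4 * s + 2) g"
  shows "\<not> wsep s (direct_prod G H)"
proof (rule not_wsep_rows_columns[where I = A and J = "{..<s + 1}"])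
  let ?m = "4 * s + 2"
  let ?R = "\<lambda>a. {a, h a} \<times> g ` {..<?m}" and ?C = "\<lambda>j. {(c, g (2 * j))}"
  have sp: "\<And>a. a \<in> A \<Longrightarrow> {c, a} \<in> gE G" "\<And>a. a \<in> A \<Longrightarrow> {a, h a} \<in> gE G" "inj_on h A" "h ` A \<inter> A = {}"
    "card A = 2 * s + 1"
    using A by (auto simp: spider_def)
  show "finite (gV (direct_prod G H))" using wf_finite[OF wf(1)] wf_finite[OF wf(2)] by simp
  show "card A = 2 * s + 1" by (rule sp)
  then have "A \<noteq> {}" by auto
  then have cV: "c \<in> gV G" using sp(1) wf_edge(1)[OF wf(1)] by blast
  show "?R a \<subseteq> gV (direct_prod G H)" if "a \<in> A" for a
    using wf_edge[OF wf(1) sp(2)[OF that]] path_in_V[OF g] by auto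
  show "?C j \<subseteq> gV (direct_prod G H)" if "j \<in> {..<s + 1}" for j
    using that cV path_in_V[OF g] by auto
  show "?R a \<inter> ?R b = {}" if "a \<in> A" "b \<in> A" "a \<noteq> b" for a b
  proof -
    have "h a \<noteq> h b" using sp(3) that by (auto dest: inj_onD)
    moreover have "h a \<noteq> b" "h b \<noteq> a" using sp(4) that by auto
    ultimately show ?thesis using that(3) by auto
  qed
  show "?C i \<inter> ?C j = {}" if "i \<in> {..<s + 1}" "j \<in> {..<s + 1}" "i \<noteq> j" for i j
    using path_in_eq[OF g, of "2 * i" "2 * j"] that by auto
  show "(a, g 1) \<in> ?R a" for a by simp
  show "rch (direct_prod G H) (?R a \<union> ?C j) (a, g 1) (c, g (2 * j))"
    if aj: "a \<in> A" "j \<in> {..<s + 1}" for a j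
  proof -
    have "rch (direct_prod G H) (?R a) (a, g 1) (a, g (1 + 2 * j))"
      using zigzag'[OF g sp(2)[OF aj(1)], of 1 j] aj by simp
    then have "rch (direct_prod G H) (?R a \<union> ?C j) (a, g 1) (a, g (1 + 2 * j))"
      by (rule rch_mono[OF _ Un_upper1])
    moreover have "rch (direct_prod G H) (?R a \<union> ?C j) (a, g (1 + 2 * j)) (c, g (2 * j))"
    proof (rule rch_step)
      have "{g (2 * j), g (Suc (2 * j))} \<in> gE H" using g aj by (auto simp: path_in_def)
      then show "{(a, g (1 + 2 * j)), (c, g (2 * j))} \<in> gE (direct_prod G H)"
        using sp(1)[OF aj(1)] by (simp add: insert_commute)
    qed (use aj in auto)
    ultimately show ?thesis by (rule rch_trans)
  qed
qed simp

text \<open>\<open>(c, b)\<close> and \<open>(a, d)\<close> are adjacent for all leaves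
  \<open>a\<close> and \<open>b\<close>, so the product contains a complete bipartite graph, whose
  vertices serve as rows and columns.\<close>

lemma not_wsep_star_star:
  assumes wf: "wf_graph G" "wf_graph H"
    and c: "2 * s + 1 \<le> card {u. {c, u} \<in> gE G}" and d: "2 * s + 1 \<le> card {v. {d, v} \<in> gE H}"
  shows "\<not> wsep s (direct_prod G H)"
proof -
  obtain A where A: "A \<subseteq> {u. {c, u} \<in> gE G}" "card A = s + 1"
    using obtain_subset_with_card_n[of "s + 1" "{u. {c, u} \<in> gE G}"] c by auto
  obtain B where B: "B \<subseteq> {v. {d, v} \<in> gE H}" "card B = 2 * s + 1"
    using obtain_subset_with_card_n[OF d] by blast
  have "A \<noteq> {}" "B \<noteq> {}" using A(2) B(2) by auto
  then have cd: "c \<in> gV G" "d \<in> gV H" using A(1) B(1) wf_edge(1)[OF wf(1)] wf_edge(1)[OF wf(2)] by blast+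
  have AV: "A \<subseteq> gV G" "B \<subseteq> gV H" using A(1) B(1) wf_edge(2)[OF wf(1)] wf_edge(2)[OF wf(2)] by blast+
  show ?thesis
  proof (rule not_wsep_rows_columns[where I = B and J = A and R = "\<lambda>b. {(c, b)}" and C = "\<lambda>a. {(a, d)}"])
    show "finite (gV (direct_prod G H))" using wf_finite[OF wf(1)] wf_finite[OF wf(2)] by simp
    show "rch (direct_prod G H) ({(c, b)} \<union> {(a, d)}) (c, b) (a, d)" if "b \<in> B" "a \<in> A" for a b
      using that A(1) B(1) by (intro rch_step) (auto simp: insert_commute)
  qed (use A(2) B(2) cd AV in auto)
qed

section \<open>Connected graphs with large vertex cover number\<close>

lemma rch_restrict:
  assumes "rch G X x y"
  shows "rch G {z \<in> X. rch G X x z} x y"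
  using assms
proof (induction rule: rch_induct)
  case (step u v)
  have "rch G X x v" using step(2) rch_step[OF step(3-5)] by (rule rch_trans)
  then have "rch G {z \<in> X. rch G X x z} u v"
    using step by (intro rch_step) auto
  with step(1) show ?case by (rule rch_trans)
qed simp

text \<open>\<open>t\<close> is the vertex after the last visit to \<open>r\<close>; from there on
  the walk avoids \<open>r\<close>.\<close>

lemma rch_first_step:
  assumes wf: "wf_graph G" and "rch G X r y" and "y \<noteq> r"
  shows "\<exists>t. {r, t} \<in> gE G \<and> t \<in> X - {r} \<and> rch G (X - {r}) t y"
proof -
  have "y = r \<or> (\<exists>t. {r, t} \<in> gE G \<and> t \<in> X - {r} \<and> rch G (X - {r}) t y)"
    using assms(2)
  proof (induction rule: rch_induct)
    case (step u v)
    consider "v = r" | "v \<noteq> r" "u = r" | "v \<noteq> r" "u \<noteq> r" by blast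
    then show ?case
    proof cases
      case 2
      then have "{r, v} \<in> gE G" "v \<in> X - {r}" "rch G (X - {r}) v v" using step by auto
      then show ?thesis by blast
    next
      case 3
      then obtain t where t: "{r, t} \<in> gE G" "t \<in> X - {r}" "rch G (X - {r}) t u"
        using step(1) by blast
      have "rch G (X - {r}) u v" using step(3-5) 3 by (intro rch_step) auto
      with t(3) have "rch G (X - {r}) t v" by (rule rch_trans)
      then show ?thesis using t by blast
    qed simp
  qed simp
  then show ?thesis using assms(3) by blast
qed

text \<open>The recursion of \<open>small_vcover\<close>: the root, and at most \<open>n\<close>
  components in which the excluded path is one vertex shorter. The value is crude; only its
  independence of the graph matters.\<close>

primrec cover_bound :: "nat \<Rightarrow> nat \<Rightarrow> nat" where
  "cover_bound n 0 = 0"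
| "cover_bound n (Suc p) = 1 + n * cover_bound n p"

text \<open>
  After deleting \<open>r\<close>, every component with an edge contributes a leg to a spider centred at \<open>r\<close>, so
  there are few of them, and inside each one the paths starting next to \<open>r\<close> are shorter.
\<close>

lemma small_vcover:
  assumes wf: "wf_graph G" and no_spider: "\<And>c A h. \<not> spider G n c A h"
    and "X \<subseteq> gV G" and "r \<in> X" and "\<And>x. x \<in> X \<Longrightarrow> rch G X r x"
    and "\<And>xs. distinct xs \<Longrightarrow> set xs \<subseteq> X \<Longrightarrow> successively (\<lambda>u v. {u, v} \<in> gE G) xs \<Longrightarrow>
      xs \<noteq> [] \<Longrightarrow> hd xs = r \<Longrightarrow> length xs \<noteq> Suc p"
  shows "\<exists>Q. vcover G X Q \<and> card Q \<le> cover_bound n p"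
  using assms(3-6)
proof (induction p arbitrary: X r)
  case 0
  \<comment> \<open>The one-vertex list \<open>[r]\<close> is a path with \<open>Suc 0\<close>
    vertices, so this case is vacuous.\<close>
  from "0.prems"(4)[of "[r]"] "0.prems"(2) show ?case by simp
next
  case (Suc p)
  let ?Z = "X - {r}"
  have finX: "finite X" using Suc.prems(1) wf_finite[OF wf] by (rule finite_subset)
  define K where "K y = {z \<in> ?Z. rch G ?Z y z}" for y
  have K_sub: "K y \<subseteq> ?Z" for y by (auto simp: K_def)
  have K_self: "y \<in> K y" if "y \<in> ?Z" for y using that by (simp add: K_def)
  have K_eq: "K x = K y" if "z \<in> K x" "z \<in> K y" for x y z
  proof -
    have xy: "rch G ?Z x y"
      using that rch_trans[of G ?Z x z y] rch_sym[of G ?Z y z] by (simp add: K_def)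
    have "rch G ?Z x v \<longleftrightarrow> rch G ?Z y v" for v
      using rch_trans[OF xy, of v] rch_trans[OF rch_sym[OF xy], of v] by blast
    then show ?thesis by (simp add: K_def)
  qed
  have K_nb: "v \<in> K y" if "u \<in> K y" "{u, v} \<in> gE G" "v \<in> ?Z" for u v y
  proof -
    have u: "u \<in> ?Z" "rch G ?Z y u" using that(1) by (simp_all add: K_def)
    show ?thesis using rch_trans[OF u(2) rch_step[OF that(2) u(1) that(3)]] that(3) by (simp add: K_def)
  qed
  \<comment> \<open>There may be arbitrarily many edgeless components, but they need no cover: their
    edges to \<open>r\<close> are covered by \<open>r\<close>. Only the components with an edge have
    to be counted.\<close>
  define \<D> where "\<D> = {D \<in> K ` ?Z. \<exists>a\<in>D. \<exists>b\<in>D. {a, b} \<in> gE G}"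
  have finD: "finite \<D>" unfolding \<D>_def using finX by simp
  \<comment> \<open>The component has a neighbour \<open>t\<close> of \<open>r\<close>. Being
    connected with at least one edge, it also contains a neighbour \<open>b\<close> of
    \<open>t\<close>, which gives the leg \<open>r\<close>, \<open>t\<close>, \<open>b\<close>. The
    clause \<open>K t = D\<close> lets \<open>D\<close> be recovered from \<open>t\<close>, as the
    feet of a spider are a function of its inner vertices.\<close>
  have leg: "\<exists>t b. t \<in> D \<and> b \<in> D \<and> {r, t} \<in> gE G \<and> {t, b} \<in> gE G \<and> K t = D" if "D \<in> \<D>" for D
  proof -
    from that obtain y a b where y: "y \<in> ?Z" "D = K y" and ab: "a \<in> D" "b \<in> D" "{a, b} \<in> gE G"
      unfolding \<D>_def by blast
    have "rch G X r y" "y \<noteq> r" using y(1) Suc.prems(3) by auto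
    from rch_first_step[OF wf this] obtain t where
      t: "{r, t} \<in> gE G" "t \<in> ?Z" "rch G ?Z t y" by blast
    have Kt: "K t = D" using K_eq[of y t y] K_self[OF y(1)] t(3) y by (simp add: K_def)
    have tD: "t \<in> D" using K_self[OF t(2)] Kt by simp
    have "\<exists>b. b \<in> D \<and> {t, b} \<in> gE G"
    proof (cases "a = t")
      case True
      then show ?thesis using ab by blast
    next
      case False
      have "rch G ?Z t a" using ab(1) Kt by (auto simp: K_def)
      from rch_first_step[OF wf this False] obtain t' where "{t, t'} \<in> gE G" "t' \<in> ?Z" by blast
      then show ?thesis using K_nb[of t t t'] K_self[OF t(2)] Kt by blast
    qed
    then show ?thesis using t(1) tD Kt by blast
  qed
  then obtain t b where tb: "\<And>D. D \<in> \<D> \<Longrightarrow> t D \<in> D" "\<And>D. D \<in> \<D> \<Longrightarrow> b D \<in> D"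
    "\<And>D. D \<in> \<D> \<Longrightarrow> {r, t D} \<in> gE G" "\<And>D. D \<in> \<D> \<Longrightarrow> {t D, b D} \<in> gE G"
    "\<And>D. D \<in> \<D> \<Longrightarrow> K (t D) = D" by metis
  have disj: "D = D'" if "D \<in> \<D>" "D' \<in> \<D>" "z \<in> D" "z \<in> D'" for D D' z
    using K_eq[of z "t D" "t D'"] tb(5) that by simp
  have cD: "card \<D> \<le> n"
  proof (rule ccontr)
    assume "\<not> card \<D> \<le> n"
    then obtain F where F: "F \<subseteq> \<D>" "card F = n" "finite F"
      using obtain_subset_with_card_n[of n \<D>] by auto
    have FD: "D \<in> \<D>" if "D \<in> F" for D using that F(1) by blast
    have "inj_on t F"
    proof (rule inj_onI)
      fix D D' assume *: "D \<in> F" "D' \<in> F" "t D = t D'"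
      have "D = K (t D)" by (rule tb(5)[OF FD[OF *(1)], symmetric])
      also have "\<dots> = D'" unfolding *(3) by (rule tb(5)[OF FD[OF *(2)]])
      finally show "D = D'" .
    qed
    then have "card (t ` F) = n" using card_image[of t F] F(2) by simp
    moreover have "inj_on (\<lambda>x. b (K x)) (t ` F)"
    proof (rule inj_onI)
      fix x y assume "x \<in> t ` F" "y \<in> t ` F" and eq: "b (K x) = b (K y)"
      then obtain D D' where D: "x = t D" "y = t D'" "D \<in> \<D>" "D' \<in> \<D>" using FD by blast
      then have "b D = b D'" using eq tb(5) by simp
      then have "D = D'" using disj[OF D(3,4), of "b D"] tb(2)[OF D(3)] tb(2)[OF D(4)] by simp
      then show "x = y" using D by simp
    qed
    moreover have "(\<lambda>x. b (K x)) ` t ` F \<inter> t ` F = {}"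
    proof (rule ccontr)
      assume "(\<lambda>x. b (K x)) ` t ` F \<inter> t ` F \<noteq> {}"
      then obtain D D' where D: "D \<in> \<D>" "D' \<in> \<D>" "b (K (t D)) = t D'" using FD by blast
      then have eq: "b D = t D'" using tb(5) by simp
      then have "D = D'" using disj[OF D(1,2), of "b D"] tb(2)[OF D(1)] tb(1)[OF D(2)] by simp
      then show False using eq wf_edge(3)[OF wf tb(4)[OF D(1)]] by simp
    qed
    moreover have "{r, x} \<in> gE G \<and> {x, b (K x)} \<in> gE G" if "x \<in> t ` F" for x
      using that tb(3,4,5) FD by auto
    ultimately have "spider G n r (t ` F) (\<lambda>x. b (K x))"
      using F(3) unfolding spider_def by simp
    then show False using no_spider by simp
  qed
  have "\<exists>Q. vcover G D Q \<and> card Q \<le> cover_bound n p" if D: "D \<in> \<D>" for D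
  proof (rule Suc.IH)
    have DZ: "D \<subseteq> ?Z" using K_sub[of "t D"] tb(5)[OF D] by simp
    show "D \<subseteq> gV G" using DZ Suc.prems(1) by auto
    show "t D \<in> D" by (rule tb(1)[OF D])
    show "rch G D (t D) x" if "x \<in> D" for x
    proof -
      have "rch G ?Z (t D) x" using that tb(5)[OF D] by (auto simp: K_def)
      then have "rch G (K (t D)) (t D) x" unfolding K_def by (rule rch_restrict)
      then show ?thesis by (simp only: tb(5)[OF D])
    qed
    fix xs assume xs: "distinct xs" "set xs \<subseteq> D" "successively (\<lambda>u v. {u, v} \<in> gE G) xs"
      "xs \<noteq> []" "hd xs = t D"
    \<comment> \<open>Prefixing \<open>r\<close> to a path starting at its neighbour
      \<open>t D\<close> lengthens it by one vertex, and it stays distinct because \<open>D\<close>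
      avoids \<open>r\<close>.\<close>
    show "length xs \<noteq> Suc p"
      using Suc.prems(4)[of "r # xs"] Suc.prems(2) xs DZ tb(3)[OF D]
      by (auto simp: successively_Cons)
  qed
  then obtain q where q: "\<And>D. D \<in> \<D> \<Longrightarrow> vcover G D (q D)"
    "\<And>D. D \<in> \<D> \<Longrightarrow> card (q D) \<le> cover_bound n p" by metis
  let ?Q = "insert r (\<Union>D\<in>\<D>. q D)"
  have "card (\<Union>D\<in>\<D>. q D) \<le> (\<Sum>D\<in>\<D>. card (q D))" by (rule card_UN_le[OF finD])
  also have "\<dots> \<le> (\<Sum>D\<in>\<D>. cover_bound n p)" by (rule sum_mono[OF q(2)])
  also have "\<dots> \<le> n * cover_bound n p" using cD by simp
  finally have "card ?Q \<le> cover_bound n (Suc p)"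
    using card_insert_le_m1[of "cover_bound n (Suc p)" "\<Union>D\<in>\<D>. q D" r] by simp
  moreover have "vcover G X ?Q"
    unfolding vcover_def
  proof (intro conjI ballI impI)
    have "q D \<subseteq> X" if "D \<in> \<D>" for D
      using q(1)[OF that] K_sub[of "t D"] tb(5)[OF that] by (auto simp: vcover_def)
    then show "?Q \<subseteq> X" using Suc.prems(2) by auto
    fix u v assume uv: "u \<in> X" "v \<in> X" "{u, v} \<in> gE G"
    show "u \<in> ?Q \<or> v \<in> ?Q"
    proof (cases "u = r \<or> v = r")
      case True
      then show ?thesis by auto
    next
      case False
      then have Z: "u \<in> ?Z" "v \<in> ?Z" using uv by auto
      then have K: "u \<in> K u" "v \<in> K u" using K_self K_nb uv(3) by auto
      then have D: "K u \<in> \<D>" using Z(1) uv(3) unfolding \<D>_def by blast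
      then have "u \<in> q (K u) \<or> v \<in> q (K u)" using q(1)[OF D] K uv(3) unfolding vcover_def by blast
      then show ?thesis using D by blast
    qed
  qed
  ultimately show ?case by blast
qed

lemma max_comp_vc_le_if_no_spider_no_path:
  assumes wf: "wf_graph G" and no_spider: "\<And>c A h. \<not> spider G n c A h"
    and no_path: "\<And>f. \<not> path_in G (Suc p) f"
  shows "max_comp_vc G \<le> cover_bound n p"
proof (rule max_comp_vc_leI[OF wf])
  fix v assume v: "v \<in> gV G"
  have comp: "component G v = {u \<in> gV G. rch G (gV G) v u}"
    using component_subset[OF wf, of v] v by (auto simp: component_def reach_iff_rch[OF wf])
  show "\<exists>Q. vcover G (component G v) Q \<and> card Q \<le> cover_bound n p"
  proof (rule small_vcover[OF wf no_spider])
    show "component G v \<subseteq> gV G" by (rule component_subset[OF wf])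
    show "v \<in> component G v" using v by (rule component_self)
    show "rch G (component G v) v x" if "x \<in> component G v" for x
      using that unfolding comp by (intro rch_restrict) simp
    fix xs assume xs: "distinct xs" "set xs \<subseteq> component G v" "successively (\<lambda>u v. {u, v} \<in> gE G) xs"
    show "length xs \<noteq> Suc p"
    proof
      assume len: "length xs = Suc p"
      have "path_in G (Suc p) (nth xs)"
        unfolding path_in_def
      proof (intro conjI allI impI)
        show "inj_on (nth xs) {..<Suc p}" using xs(1) len by (auto simp: inj_on_def nth_eq_iff_index_eq)
        have "nth xs ` {..<Suc p} = set xs" using len by (auto simp: set_conv_nth)
        then show "nth xs ` {..<Suc p} \<subseteq> gV G" using xs(2) component_subset[OF wf, of v] by auto
        show "{xs ! i, xs ! Suc i} \<in> gE G" if "Suc i < Suc p" for i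
          using xs(3) that len by (simp add: successively_conv_nth)
      qed
      then show False using no_path by simp
    qed
  qed
qed

text \<open>Every vertex of the component other than \<open>v\<close> has a neighbour, and that edge
  is covered, so the vertex lies in the closed neighbourhood of the cover. The summand 1 is for
  \<open>v\<close>, which may be isolated with an empty cover.\<close>

lemma max_comp_size_le_vc_degree:
  assumes wf: "wf_graph G" and c: "max_comp_vc G \<le> c" and d: "max_degree G \<le> d"
  shows "max_comp_size G \<le> 1 + c * (d + 1)"
proof (rule max_comp_size_leI[OF wf])
  fix v assume v: "v \<in> gV G"
  let ?D = "component G v"
  obtain Q where Q: "vcover G ?D Q" "card Q \<le> c"
    using component_vcover[OF wf v] c le_trans by blast
  have DV: "?D \<subseteq> gV G" by (rule component_subset[OF wf])
  have QV: "Q \<subseteq> gV G" using Q(1) DV by (auto simp: vcover_def)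
  let ?N = "\<Union>q\<in>Q. insert q {u. {q, u} \<in> gE G}"
  have "?D \<subseteq> insert v ?N"
  proof
    fix x assume x: "x \<in> ?D"
    show "x \<in> insert v ?N"
    proof (cases "x = v")
      case False
      have "rch G (gV G) v x" using x by (simp add: component_def reach_iff_rch[OF wf])
      from rch_first_step[OF wf rch_sym[OF this]] False obtain t where t: "{x, t} \<in> gE G" by blast
      have "t \<in> ?D" using wf t x by (rule component_closed)
      then have "x \<in> Q \<or> t \<in> Q" using Q(1) x t by (auto simp: vcover_def)
      moreover have "{t, x} \<in> gE G" using t by (simp add: insert_commute)
      ultimately show ?thesis by blast
    qed simp
  qed
  moreover have "finite ?N"
    using finite_subset[OF QV wf_finite[OF wf]] finite_neighbours[OF wf] by simp
  ultimately have "card ?D \<le> card (insert v ?N)" by (intro card_mono) auto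
  also have "\<dots> \<le> 1 + card ?N" by (simp add: card_insert_le_m1)
  also have "card ?N \<le> card Q * (d + 1)" by (rule card_closed_nbhd_le[OF wf QV d])
  also have "\<dots> \<le> c * (d + 1)" using Q(2) by (rule mult_le_mono1)
  finally show "card ?D \<le> 1 + c * (d + 1)" by simp
qed

section \<open>Unbounded parameters force the obstructions\<close>

lemma spider_le_max_degree:
  assumes wf: "wf_graph G" and sp: "spider G n c A h"
  shows "n \<le> max_degree G"
proof (cases "A = {}")
  case False
  have A: "A \<subseteq> {u. {c, u} \<in> gE G}" "card A = n" using sp by (auto simp: spider_def)
  then have "c \<in> gV G" using False wf_edge(1)[OF wf] by blast
  have "card A \<le> card {u. {c, u} \<in> gE G}" using finite_neighbours[OF wf] A(1) by (rule card_mono)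
  also have "\<dots> \<le> max_degree G" using wf \<open>c \<in> gV G\<close> by (rule card_neighbours_le)
  finally show ?thesis using A(2) by simp
qed (use sp in \<open>auto simp: spider_def\<close>)

lemma max_degree_attained:
  assumes wf: "wf_graph G" and "n < max_degree G"
  shows "\<exists>c. n < card {u. {c, u} \<in> gE G}"
proof -
  have "max_degree G \<in> insert 0 (degree G ` gV G)"
    unfolding max_degree_def using wf_finite[OF wf] by (intro Max_in) auto
  then show ?thesis using assms(2) degree_eq_card_neighbours[OF wf] by auto
qed

lemma bounded_degree_if_wsep:
  assumes wf: "\<And>G. G \<in> C \<Longrightarrow> wf_graph G" "\<And>H. H \<in> D \<Longrightarrow> wf_graph H"
    and sep: "\<And>G H. G \<in> C \<Longrightarrow> H \<in> D \<Longrightarrow> wsep s (direct_prod G H)"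
  shows "bounded_param max_degree C \<or> bounded_param max_degree D"
proof (rule ccontr)
  assume "\<not> ?thesis"
  then obtain G H where GH: "G \<in> C" "2 * s < max_degree G" "H \<in> D" "2 * s < max_degree H"
    unfolding bounded_param_def by (meson not_le)
  obtain c d where "2 * s < card {u. {c, u} \<in> gE G}" "2 * s < card {v. {d, v} \<in> gE H}"
    using max_degree_attained[OF wf(1)[OF GH(1)] GH(2)] max_degree_attained[OF wf(2)[OF GH(3)] GH(4)] by blast
  then have "\<not> wsep s (direct_prod G H)"
    using wf GH by (intro not_wsep_star_star[of _ _ _ c d]) auto
  then show False using sep GH by blast
qed

text \<open>Large components of bounded degree need large covers, and bounded degree rules out
  spiders with \<open>d + 1\<close> legs, so \<open>D\<close> supplies a long path. A large cover
  number in \<open>C\<close> supplies a spider or a path, and either is an obstruction when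
  multiplied by the path from \<open>D\<close>.\<close>

lemma bounded_vc_or_size_if_wsep:
  assumes wf: "\<And>G. G \<in> C \<Longrightarrow> wf_graph G" "\<And>H. H \<in> D \<Longrightarrow> wf_graph H"
    and sep: "\<And>G H. G \<in> C \<Longrightarrow> H \<in> D \<Longrightarrow> wsep s (direct_prod G H)"
    and deg: "bounded_param max_degree D"
  shows "bounded_param max_comp_vc C \<or> bounded_param max_comp_size D"
proof (rule ccontr)
  assume contra: "\<not> ?thesis"
  \<comment> \<open>\<open>Suc ?p\<close> is the number \<open>4 * s + 2\<close> of path vertices
    that both obstructions with a path ask for.\<close>
  let ?p = "4 * s + 1"
  have m: "4 * s + 2 = Suc ?p" by simp
  obtain d where d: "\<And>H. H \<in> D \<Longrightarrow> max_degree H \<le> d" using deg unfolding bounded_param_def by blast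
  obtain H where H: "H \<in> D" "1 + cover_bound (d + 1) ?p * (d + 1) < max_comp_size H"
    using contra unfolding bounded_param_def by (meson not_le)
  have "\<not> max_comp_vc H \<le> cover_bound (d + 1) ?p"
    using max_comp_size_le_vc_degree[OF wf(2)[OF H(1)] _ d[OF H(1)], of "cover_bound (d + 1) ?p"] H(2)
    by linarith
  moreover have "\<not> spider H (d + 1) c A h" for c A h
    using spider_le_max_degree[OF wf(2)[OF H(1)], of "d + 1" c A h] d[OF H(1)] by auto
  ultimately obtain g where g: "path_in H (Suc ?p) g"
    using max_comp_vc_le_if_no_spider_no_path[OF wf(2)[OF H(1)], of "d + 1" ?p] by blast
  obtain G where G: "G \<in> C" "cover_bound (2 * s + 1) ?p < max_comp_vc G"
    using contra unfolding bounded_param_def by (meson not_le)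
  then consider c A h where "spider G (2 * s + 1) c A h" | f where "path_in G (Suc ?p) f"
    using max_comp_vc_le_if_no_spider_no_path[OF wf(1)[OF G(1)], of "2 * s + 1" ?p] not_less by blast
  then have "\<not> wsep s (direct_prod G H)"
  proof cases
    case 1
    then show ?thesis using not_wsep_spider_path[OF wf(1)[OF G(1)] wf(2)[OF H(1)]] g m by metis
  next
    case 2
    then show ?thesis using not_wsep_path_path[OF wf(1)[OF G(1)] wf(2)[OF H(1)]] g m by metis
  qed
  then show False using sep[OF G(1) H(1)] by simp
qed

section \<open>The equivalence\<close>

lemma K2_mem:
  assumes "graph_class C" and "contains_K2 C"
  shows "K2 \<in> C"
  using assms K2_simps(2) unfolding graph_class_def contains_K2_def by blast

theorem mainTheorem19:
  fixes G1 G2 :: "nat graph set"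
  assumes "monotone_class G1" and "monotone_class G2"
    and "contains_K2 G1" and "contains_K2 G2"
  shows "bounded_param treewidth (prod_class G1 G2) \<longleftrightarrow>
     (bounded_param treewidth G1 \<and> bounded_param treewidth G2 \<and>
      ((bounded_param max_comp_size G1 \<or> bounded_param max_comp_size G2) \<or>
       (bounded_param max_comp_vc G1 \<and> bounded_param max_degree G2) \<or>
       (bounded_param max_comp_vc G2 \<and> bounded_param max_degree G1)))"
proof -
  have cl: "graph_class G1" "graph_class G2"
    using assms(1,2) unfolding monotone_class_def by simp_all
  have wf1: "wf_graph G" if "G \<in> G1" for G using cl(1) that unfolding graph_class_def by blast
  have wf2: "wf_graph G" if "G \<in> G2" for G using cl(2) that unfolding graph_class_def by blast
  have K: "K2 \<in> G1" "K2 \<in> G2" using K2_mem cl assms(3,4) by simp_all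
  have wfP: "wf_graph P" if "P \<in> prod_class G1 G2" for P
    using that wf_direct_prod[OF wf1 wf2] unfolding prod_class_def by blast
  have tw1: "bounded_param treewidth G1 \<longleftrightarrow> (\<exists>s. \<forall>G\<in>G1. wsep s G)"
    by (rule bounded_treewidth_iff_wsep[OF wf1])
  have tw2: "bounded_param treewidth G2 \<longleftrightarrow> (\<exists>s. \<forall>G\<in>G2. wsep s G)"
    by (rule bounded_treewidth_iff_wsep[OF wf2])
  have comm: "wsep s (direct_prod G H) \<longleftrightarrow> wsep s (direct_prod H G)"
    if "G \<in> G1" "H \<in> G2" for s G H
    using wsep_direct_prod_commute[of s G H] wsep_direct_prod_commute[of s H G]
      wf_finite[OF wf1[OF that(1)]] wf_finite[OF wf2[OF that(2)]] by blast
  have "bounded_param treewidth (prod_class G1 G2) \<longleftrightarrow> (\<exists>s. \<forall>P\<in>prod_class G1 G2. wsep s P)"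
    by (rule bounded_treewidth_iff_wsep[OF wfP])
  also have "\<dots> \<longleftrightarrow> (\<exists>s. \<forall>G\<in>G1. \<forall>H\<in>G2. wsep s (direct_prod G H))"
    unfolding prod_class_def by blast
  also have "\<dots> \<longleftrightarrow> (bounded_param treewidth G1 \<and> bounded_param treewidth G2 \<and>
      ((bounded_param max_comp_size G1 \<or> bounded_param max_comp_size G2) \<or>
       (bounded_param max_comp_vc G1 \<and> bounded_param max_degree G2) \<or>
       (bounded_param max_comp_vc G2 \<and> bounded_param max_degree G1)))" (is "?L \<longleftrightarrow> ?R")
  proof
    assume ?L
    then obtain s where s: "\<And>G H. G \<in> G1 \<Longrightarrow> H \<in> G2 \<Longrightarrow> wsep s (direct_prod G H)" by blast
    have s': "wsep s (direct_prod H G)" if "H \<in> G2" "G \<in> G1" for H G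
      using s[OF that(2,1)] comm[OF that(2,1)] by simp
    \<comment> \<open>\<open>K2\<close> is taken as the other factor, so the product is the
      bipartite double cover of \<open>G\<close>.\<close>
    have "wsep (2 * s) G" if "G \<in> G1" for G
      using wf1[OF that] s[OF that K(2)] by (rule wsep_double_cover)
    moreover have "wsep (2 * s) G" if "G \<in> G2" for G
      using wf2[OF that] s'[OF that K(1)] by (rule wsep_double_cover)
    ultimately have "bounded_param treewidth G1" "bounded_param treewidth G2"
      unfolding tw1 tw2 by blast+
    moreover have "bounded_param max_degree G1 \<or> bounded_param max_degree G2"
      using wf1 wf2 s by (rule bounded_degree_if_wsep)
    moreover have "bounded_param max_comp_vc G1 \<or> bounded_param max_comp_size G2"
      if "bounded_param max_degree G2"
      using wf1 wf2 s that by (rule bounded_vc_or_size_if_wsep)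
    moreover have "bounded_param max_comp_vc G2 \<or> bounded_param max_comp_size G1"
      if "bounded_param max_degree G1"
      using wf2 wf1 s' that by (rule bounded_vc_or_size_if_wsep)
    \<comment> \<open>If the degrees in \<open>G2\<close> are bounded, a bound on
      \<open>max_comp_vc\<close> in \<open>G1\<close> is alternative (ii) and a bound on
      \<open>max_comp_size\<close> in \<open>G2\<close> is alternative (i). Bounded degrees in
      \<open>G1\<close> give (iii) or (i) in the same way.\<close>
    ultimately show ?R by blast
  next
    assume R: ?R
    then obtain s1 s2 where s1: "\<And>G. G \<in> G1 \<Longrightarrow> wsep s1 G" and s2: "\<And>G. G \<in> G2 \<Longrightarrow> wsep s2 G"
      unfolding tw1 tw2 by blast
    from R consider (size1) k where "\<And>G. G \<in> G1 \<Longrightarrow> max_comp_size G \<le> k"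
      | (size2) k where "\<And>G. G \<in> G2 \<Longrightarrow> max_comp_size G \<le> k"
      | (vc1) c d where "\<And>G. G \<in> G1 \<Longrightarrow> max_comp_vc G \<le> c" "\<And>G. G \<in> G2 \<Longrightarrow> max_degree G \<le> d"
      | (vc2) c d where "\<And>G. G \<in> G2 \<Longrightarrow> max_comp_vc G \<le> c" "\<And>G. G \<in> G1 \<Longrightarrow> max_degree G \<le> d"
      unfolding bounded_param_def by blast
    then show ?L
    proof cases
      case size1
      have "wsep (s2 * k) (direct_prod G H)" if "G \<in> G1" "H \<in> G2" for G H
        using wsep_direct_prod_small_components[OF wf2 wf1 s2 size1] that comm[OF that] by simp
      then show ?thesis by blast
    next
      case size2
      have "wsep (s1 * k) (direct_prod G H)" if "G \<in> G1" "H \<in> G2" for G H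
        using wsep_direct_prod_small_components[OF wf1 wf2 s1 size2] that by simp
      then show ?thesis by blast
    next
      case vc1
      have "wsep (c * (s2 * (d + 1)) + 1) (direct_prod G H)" if "G \<in> G1" "H \<in> G2" for G H
        using wsep_direct_prod_vc_degree[OF wf1 wf2 s2 vc1] that by simp
      then show ?thesis by blast
    next
      case vc2
      have "wsep (c * (s1 * (d + 1)) + 1) (direct_prod G H)" if "G \<in> G1" "H \<in> G2" for G H
        using wsep_direct_prod_vc_degree[OF wf2 wf1 s1 vc2] that comm[OF that] by simp
      then show ?thesis by blast
    qed
  qed
  finally show ?thesis .
qed

end
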